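(* Let $K \geq 1$ and let $N_1, \dots, N_K \geq 1$ be integers. Let $f_k \in \mathcal{L}(N_k)$ and let $t_k > 0$ be real numbers, $1 \leq k \leq K$. Then $$\left\| \left( \sum_{k=1}^K t_k|D_{N_k}(e^{i\theta})|^2 \right)^{1/2}\right\|_{p} \leq \left\| \left( \sum_{k=1}^K t_k|f_{k}(e^{i\theta})|^2 \right)^{1/2}\right\|_{p} \quad \text{for all real } p \text{ with } 0 < p \leq 2,$$ and $$\left\| \left( \sum_{k=1}^K t_k|D_{N_k}(e^{i\theta})|^2 \right)^{1/2}\right\|_{p} \geq \left\| \left( \sum_{k=1}^K t_k|f_{k}(e^{i\theta})|^2 \right)^{1/2}\right\|_{p} \quad \text{for all real } p \text{ with } 2 \leq p \leq 4.$$
   Context: For each integer $N \geq 1$, $\mathcal{L}(N)$ denotes the collection of all complex polynomials $f$ of the form $f(z) = c_0 + c_1 z + c_2 z^{2} + \dots + c_{N-1} z^{N-1}$ where each $c_j \in \{1,-1\}$ (Littlewood polynomials). The polynomial $D_N \in \mathcal{L}(N)$ is defined by $D_N(z) = 1 + z + z^2 + \dots + z^{N-1}$. For a function $g$ of $\theta \in [0,2\pi]$ and real $p>0$, $\|g\|_p := \left(\int_0^{2\pi} |g(\theta)|^p \, d\theta/2\pi\right)^{1/p}$ (for $p<1$ this is only a quasi-norm, but the same notation is used). *)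

theory Defs
  imports "HOL-Analysis.Analysis" "HOL-Computational_Algebra.Polynomial"
begin

definition littlewood_polys :: "nat \<Rightarrow> complex poly set" where
  "littlewood_polys N =
     {f. \<exists>c. (\<forall>j<N. c j \<in> {1, -1}) \<and> f = (\<Sum>j<N. monom (c j) j)}"

definition dirichlet_poly :: "nat \<Rightarrow> complex poly" where
  "dirichlet_poly N = (\<Sum>j<N. monom 1 j)"

text \<open>
  The integral is total: a non-integrable integrand would get the value \<open>0\<close>.
  This is harmless for continuous \<open>g\<close> and \<open>p > 0\<close>, where the integrand is
  continuous, also at zeros of \<open>g\<close> since \<open>0 powr p = 0\<close>.
\<close>
definition circle_norm :: "real \<Rightarrow> (real \<Rightarrow> 'a::real_normed_vector) \<Rightarrow> real" where
  "circle_norm p g =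
     ((LINT \<theta>:{0..2*pi}|lborel. norm (g \<theta>) powr p) / (2*pi)) powr (1/p)"

end

theory Submission
  imports Defs "HOL-Number_Theory.Cong" "HOL-Real_Asymp.Real_Asymp" "Jordan_Normal_Form.Determinant"
begin

text \<open>
  Put \<open>F = \<Sum> t\<^sub>k |f\<^sub>k|\<^sup>2\<close> and \<open>G = \<Sum> t\<^sub>k |D\<^sub>k|\<^sup>2\<close>, where \<open>D\<^sub>k\<close> has the length of \<open>f\<^sub>k\<close>. The
  heart of the matter is \<open>\<integral> ln (1 + s G) \<le> \<integral> ln (1 + s F)\<close> for all \<open>s > 0\<close>. The product of \<open>1 + s F\<close> over the
  \<open>m\<close>-th roots of unity is the determinant of an \<open>m \<times> m\<close> Gram matrix built from the cyclic shifts of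
  the coefficient vectors. By Cauchy-Binet it is a nonnegative combination of squared minors. Only a bounded number
  of the shifts wrap around, and deleting these changes the determinant by a factor polynomial in \<open>m\<close>.
  The remaining integer minors for \<open>f\<close> and \<open>D\<close> agree modulo 2, while those for \<open>D\<close> are minors of an interval
  matrix and hence lie in \<open>{-1, 0, 1}\<close>; so every minor for \<open>f\<close> dominates. Taking logarithms,
  dividing by \<open>m\<close> and letting \<open>m\<close> tend to infinity gives the claim.

  Finally \<open>x powr q\<close> is a positive multiple of \<open>\<integral> ln (1 + s x) s powr (-q - 1) ds\<close> for \<open>0 < q < 1\<close>, and of
  the same integral with \<open>s x - ln (1 + s x)\<close> for \<open>1 < q < 2\<close>. Since \<open>\<integral> F = \<integral> G\<close>, the inequality
  turns around in the second range; \<open>q = 2\<close> follows from the expansion at \<open>s = 0\<close>.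
\<close>

section \<open>Minors of Gram matrices\<close>

text \<open>A label stands abstractly for a vector; later it is a pair of a polynomial index and a
  cyclic shift, so that one selection \<open>g\<close> picks corresponding minors for two
  coefficient families.\<close>

definition row_det :: "nat \<Rightarrow> ('c \<Rightarrow> nat \<Rightarrow> 'a::comm_ring_1) \<Rightarrow> (nat \<Rightarrow> 'c) \<Rightarrow> 'a" where
  "row_det n v g = det (mat n n (\<lambda>(i,j). v (g i) j))"

text \<open>
  Indexing the minors by all maps \<open>g\<close> rather than by \<open>n\<close>-subsets counts every minor \<open>n!\<close> times.
\<close>
definition minor_sum :: "nat \<Rightarrow> ('c \<Rightarrow> real) \<Rightarrow> ('c \<Rightarrow> nat \<Rightarrow> real) \<Rightarrow> 'c set \<Rightarrow> real" where
  "minor_sum n W v J =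
     (\<Sum>g\<in>{0..<n} \<rightarrow>\<^sub>E J. (\<Prod>i=0..<n. W (g i)) * (row_det n v g)\<^sup>2)"

lemma det_mat_leibniz:
  "det (mat n n (\<lambda>(i,j). f i j)) = (\<Sum>p | p permutes {0..<n}. signof p * (\<Prod>i=0..<n. f i (p i)))"
proof (subst det_def'[where n = n], simp, rule sum.cong[OF refl])
  fix p assume "p \<in> {p. p permutes {0..<n}}"
  then have p: "p permutes {0..<n}" by simp
  have "(\<Prod>i=0..<n. mat n n (\<lambda>(i,j). f i j) $$ (i, p i)) = (\<Prod>i=0..<n. f i (p i))"
    by (rule prod.cong[OF refl]) (use permutes_in_image[OF p] in simp)
  then show "signof p * (\<Prod>i=0..<n. mat n n (\<lambda>(i,j). f i j) $$ (i, p i)) =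
      signof p * (\<Prod>i=0..<n. f i (p i))" by (rule arg_cong)
qed

lemma row_det_leibniz:
  "row_det n v g = (\<Sum>p | p permutes {0..<n}. signof p * (\<Prod>i=0..<n. v (g i) (p i)))"
  unfolding row_det_def by (rule det_mat_leibniz)

lemma row_det_leibniz':
  "row_det n v g = (\<Sum>p | p permutes {0..<n}. signof p * (\<Prod>i=0..<n. v (g (p i)) i))"
proof -
  have "row_det n v g = det (transpose_mat (mat n n (\<lambda>(i,j). v (g i) j)))"
    unfolding row_det_def by (rule det_transpose[symmetric, where n = n]) simp
  also have "transpose_mat (mat n n (\<lambda>(i,j). v (g i) j)) = mat n n (\<lambda>(i,j). v (g j) i)"
    by (rule eq_matI) simp_all
  finally show ?thesis by (simp only: det_mat_leibniz)
qed

lemma row_det_permute: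
  assumes p: "p permutes {0..<n}"
  shows "row_det n v (g \<circ> p) = signof p * row_det n v g"
proof -
  let ?A = "mat n n (\<lambda>(i,j). v (g i) j)"
  have "p i < n" if "i < n" for i using permutes_in_image[OF p, of i] that by simp
  then have "mat n n (\<lambda>(i,j). v ((g \<circ> p) i) j) = mat n n (\<lambda>(i,j). ?A $$ (p i, j))"
    by (intro eq_matI) simp_all
  moreover have "det (mat n n (\<lambda>(i,j). ?A $$ (p i, j))) = signof p * det ?A"
    by (rule det_permute_rows[OF _ p]) simp
  ultimately show ?thesis unfolding row_det_def by (rule trans[OF arg_cong])
qed

lemma row_det_eq_0:
  assumes "i < n" "j < n" "i \<noteq> j" "g i = g j"
  shows "row_det n v g = 0"
  unfolding row_det_def
  by (rule det_identical_rows[OF _ assms(3,1,2)]) (use assms in \<open>auto intro!: eq_vecI\<close>)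

text \<open>Laplace expansion in disguise: the cofactors along row \<open>i\<close> do not see that
  row, and putting the unit vector labelled \<open>b r\<close> there leaves exactly the
  \<open>r\<close>-th cofactor. The cofactors thus become minors of the same family.\<close>

lemma row_det_expand_row:
  fixes v :: "'c \<Rightarrow> nat \<Rightarrow> 'a::comm_ring_1"
  assumes "i < n"
    and unit: "\<And>r j. r < n \<Longrightarrow> j < n \<Longrightarrow> v (b r) j = (if j = r then 1 else 0)"
  shows "row_det n v g = (\<Sum>r<n. v (g i) r * row_det n v (g(i := b r)))"
proof -
  let ?A = "\<lambda>g. mat n n (\<lambda>(i,j). v (g i) j)"
  have carr: "?A h \<in> carrier_mat n n" for h by simp
  have del: "mat_delete (?A (g(i := x))) i j = mat_delete (?A g) i j" for x j
    unfolding mat_delete_def by (auto intro!: eq_matI)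
  have cof: "cofactor (?A (g(i := x))) i j = cofactor (?A g) i j" for x j
    unfolding cofactor_def del ..
  have entry: "?A (g(i := b r)) $$ (i,j) = (if j = r then 1 else 0)" if "r < n" "j < n" for r j
    using unit[OF that] assms(1) that by simp
  have "row_det n v (g(i := b r)) = cofactor (?A g) i r" if r: "r < n" for r
  proof -
    have "row_det n v (g(i := b r)) = (\<Sum>j<n. ?A (g(i := b r)) $$ (i,j) * cofactor (?A (g(i := b r))) i j)"
      unfolding row_det_def by (rule laplace_expansion_row[OF carr assms(1)])
    also have "\<dots> = (\<Sum>j<n. if j = r then cofactor (?A g) i r else 0)"
      unfolding cof using entry[OF r] by (intro sum.cong refl) (simp del: index_mat)
    finally show ?thesis using r by simp
  qed
  then show ?thesis
    unfolding row_det_def[of n v g]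
    by (subst laplace_expansion_row[OF carr assms(1)]) (auto intro!: sum.cong simp: assms(1))
qed

text \<open>Cauchy-Binet. Multiplying out the row sums gives, for each selection \<open>g\<close>, a
  determinant times a bare product of entries; symmetrising over permutations of \<open>g\<close>
  turns that product into a second copy of the determinant, at the price of
  \<open>fact n\<close>.\<close>

lemma det_gram_eq_minor_sum:
  fixes W :: "'c \<Rightarrow> real"
  assumes "finite J"
  shows "det (mat n n (\<lambda>(i,j). \<Sum>c\<in>J. W c * v c i * v c j)) = minor_sum n W v J / fact n"
proof -
  let ?P = "{p. p permutes {0..<n}}"
  let ?G = "{0..<n} \<rightarrow>\<^sub>E J"
  let ?H = "\<lambda>g. (\<Prod>i=0..<n. W (g i)) * (\<Prod>i=0..<n. v (g i) i) * row_det n v g"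
  let ?D = "det (mat n n (\<lambda>(i,j). \<Sum>c\<in>J. W c * v c i * v c j))"
  have "?D = (\<Sum>p\<in>?P. signof p * (\<Prod>i=0..<n. \<Sum>c\<in>J. W c * v c i * v c (p i)))"
    by (rule det_mat_leibniz)
  also have "\<dots> = (\<Sum>p\<in>?P. signof p * (\<Sum>g\<in>?G. \<Prod>i=0..<n. W (g i) * v (g i) i * v (g i) (p i)))"
    using assms by (simp add: prod_sum_PiE)
  also have "\<dots> = (\<Sum>g\<in>?G. \<Sum>p\<in>?P. signof p * (\<Prod>i=0..<n. W (g i) * v (g i) i * v (g i) (p i)))"
    unfolding sum_distrib_left by (rule sum.swap)
  also have "\<dots> = (\<Sum>g\<in>?G. ?H g)"
    unfolding row_det_leibniz sum_distrib_left prod.distrib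
    by (intro sum.cong refl) (simp only: mult_ac)
  finally have D: "?D = (\<Sum>g\<in>?G. ?H g)" .
  have reindex: "(\<Sum>g\<in>?G. ?H (g \<circ> p)) = (\<Sum>g\<in>?G. ?H g)" if p: "p permutes {0..<n}" for p
  proof (rule sum.reindex_bij_witness[where i = "\<lambda>g. g \<circ> Hilbert_Choice.inv p" and j = "\<lambda>g. g \<circ> p"])
    fix g assume g: "g \<in> ?G"
    show "g \<circ> p \<circ> Hilbert_Choice.inv p = g" "g \<circ> Hilbert_Choice.inv p \<circ> p = g"
      using permutes_inv_o[OF p] by (simp_all add: comp_assoc)
    have *: "g \<circ> q \<in> ?G" if q: "q permutes {0..<n}" for q
      using g permutes_in_image[OF q] permutes_not_in[OF q]
      by (auto simp: PiE_def Pi_def extensional_def)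
    show "g \<circ> p \<in> ?G" "g \<circ> Hilbert_Choice.inv p \<in> ?G" using * p permutes_inv[OF p] by auto
  qed (rule refl)
  have Hp: "?H (g \<circ> p) = (\<Prod>i=0..<n. W (g i)) * (\<Prod>i=0..<n. v (g (p i)) i) * (signof p * row_det n v g)"
    if p: "p permutes {0..<n}" for g p
  proof -
    have "(\<Prod>i=0..<n. W (g (p i))) = (\<Prod>i=0..<n. W (g i))"
      using prod.permute[OF p, of "\<lambda>i. W (g i)"] by (simp add: comp_def)
    then show ?thesis by (simp only: row_det_permute[OF p] comp_apply)
  qed
  \<comment> \<open>Each permutation \<open>p\<close> merely reindexes the selections, so all
    summands equal \<open>?D\<close>; the signs from \<open>row_det_permute\<close> then assemble
    the Leibniz sum of the transposed minor.\<close>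
  have "fact n * ?D = (\<Sum>p\<in>?P. ?D)"
    by (simp only: sum_constant card_permutations[OF refl finite_atLeastLessThan] card_atLeastLessThan of_nat_fact diff_zero)
  also have "\<dots> = (\<Sum>p\<in>?P. \<Sum>g\<in>?G. ?H (g \<circ> p))"
  proof (rule sum.cong[OF refl])
    fix p assume "p \<in> ?P"
    then have "p permutes {0..<n}" by simp
    from reindex[OF this] show "?D = (\<Sum>g\<in>?G. ?H (g \<circ> p))" unfolding D by (rule sym)
  qed
  also have "\<dots> = (\<Sum>g\<in>?G. \<Sum>p\<in>?P. ?H (g \<circ> p))" by (rule sum.swap)
  also have "\<dots> = (\<Sum>g\<in>?G. (\<Prod>i=0..<n. W (g i)) * row_det n v g * row_det n v g)"
  proof (rule sum.cong[OF refl])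
    fix g
    have "(\<Sum>p\<in>?P. ?H (g \<circ> p)) =
        (\<Sum>p\<in>?P. (\<Prod>i=0..<n. W (g i)) * row_det n v g * (signof p * (\<Prod>i=0..<n. v (g (p i)) i)))"
    proof (rule sum.cong[OF refl])
      fix p assume "p \<in> ?P"
      then have "p permutes {0..<n}" by simp
      from Hp[OF this] show "?H (g \<circ> p) =
          (\<Prod>i=0..<n. W (g i)) * row_det n v g * (signof p * (\<Prod>i=0..<n. v (g (p i)) i))"
        by (simp only: mult_ac)
    qed
    then show "(\<Sum>p\<in>?P. ?H (g \<circ> p)) = (\<Prod>i=0..<n. W (g i)) * row_det n v g * row_det n v g"
      by (simp only: sum_distrib_left[symmetric] row_det_leibniz'[symmetric])
  qed
  finally have "fact n * ?D = minor_sum n W v J"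
    by (simp only: minor_sum_def power2_eq_square mult.assoc)
  then show ?thesis by (simp only: nonzero_eq_divide_eq[OF fact_nonzero] mult.commute[of ?D])
qed

lemma minor_sum_mono:
  assumes "finite J'" "J \<subseteq> J'" "\<And>c. c \<in> J' \<Longrightarrow> W c \<ge> 0"
  shows "minor_sum n W v J \<le> minor_sum n W v J'"
  unfolding minor_sum_def
proof (rule sum_mono2)
  show "finite ({0..<n} \<rightarrow>\<^sub>E J')" using assms(1) by (intro finite_PiE) auto
  show "{0..<n} \<rightarrow>\<^sub>E J \<subseteq> {0..<n} \<rightarrow>\<^sub>E J'" using assms(2) by (intro PiE_mono)
qed (use assms(3) in \<open>auto intro!: mult_nonneg_nonneg prod_nonneg simp: PiE_def Pi_def\<close>)

text \<open>
  In a minor using the column \<open>a\<close>, expand \<open>a\<close> in unit vectors; each of these is itself a column of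
  weight 1, so Cauchy-Schwarz bounds the minor by minors that do not use \<open>a\<close>.
\<close>
lemma minor_sum_insert_le:
  fixes W :: "'c \<Rightarrow> real"
  assumes fin: "finite J" and a: "a \<notin> J" and W: "\<And>c. c \<in> insert a J \<Longrightarrow> W c \<ge> 0"
    and bJ: "\<And>r. r < n \<Longrightarrow> b r \<in> J" and Wb: "\<And>r. r < n \<Longrightarrow> W (b r) = 1"
    and unit: "\<And>r j. r < n \<Longrightarrow> j < n \<Longrightarrow> v (b r) j = (if j = r then 1 else 0)"
  shows "minor_sum n W v (insert a J) \<le> (1 + n * W a * (\<Sum>r<n. (v a r)\<^sup>2)) * minor_sum n W v J"
proof -
  let ?I = "{0..<n}"
  let ?T = "\<lambda>g. (\<Prod>i=0..<n. W (g i)) * (row_det n v g)\<^sup>2"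
  let ?G = "?I \<rightarrow>\<^sub>E J" and ?G' = "?I \<rightarrow>\<^sub>E insert a J"
  \<comment> \<open>Selections using \<open>a\<close> at position \<open>i\<close> and nowhere else;
    a repeated \<open>a\<close> makes the minor vanish.\<close>
  define X where "X i = {g \<in> ?G'. g i = a \<and> (\<forall>j\<in>?I - {i}. g j \<noteq> a)}" for i
  define S where "S = (\<Sum>r<n. (v a r)\<^sup>2)"
  have S: "S \<ge> 0" unfolding S_def by (simp add: sum_nonneg)
  have binj: "inj_on b {..<n}"
  proof (rule inj_onI)
    fix r s assume "r \<in> {..<n}" "s \<in> {..<n}" "b r = b s"
    then show "r = s" using unit[of r r] unit[of s r] by (auto split: if_splits)
  qed
  have finG': "finite ?G'" "finite ?G" using fin by (auto intro!: finite_PiE)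
  have Tpos: "?T g \<ge> 0" if "g \<in> ?G'" for g
    using that W by (intro mult_nonneg_nonneg prod_nonneg) (auto simp: PiE_def Pi_def)
  have step: "(\<Sum>g\<in>X i. ?T g) \<le> W a * S * minor_sum n W v J" if i: "i < n" for i
  proof -
    have T_le: "?T g \<le> W a * S * (\<Sum>r<n. ?T (g(i := b r)))" if g: "g \<in> X i" for g
    proof -
      have gi: "g i = a" and gJ: "\<And>j. j \<in> ?I - {i} \<Longrightarrow> g j \<in> J"
        using g unfolding X_def PiE_def Pi_def by auto
      let ?Q = "\<Prod>j\<in>?I - {i}. W (g j)"
      have Q: "?Q \<ge> 0" using gJ W by (intro prod_nonneg) auto
      have W1: "(\<Prod>j=0..<n. W (g j)) = W a * ?Q"
        using i gi by (subst prod.remove[of _ i]) auto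
      have W2: "(\<Prod>j=0..<n. W ((g(i := b r)) j)) = ?Q" if "r < n" for r
        using i Wb[OF that] by (subst prod.remove[of _ i]) auto
      have "(row_det n v g)\<^sup>2 = (\<Sum>r<n. v a r * row_det n v (g(i := b r)))\<^sup>2"
        using row_det_expand_row[OF i, of v b g] unit gi by simp
      also have "\<dots> \<le> S * (\<Sum>r<n. (row_det n v (g(i := b r)))\<^sup>2)"
        unfolding S_def by (rule Cauchy_Schwarz_ineq_sum)
      finally have "?T g \<le> W a * ?Q * (S * (\<Sum>r<n. (row_det n v (g(i := b r)))\<^sup>2))"
        unfolding W1 using Q W by (intro mult_left_mono) auto
      also have "\<dots> = W a * S * (\<Sum>r<n. ?T (g(i := b r)))"
        using W2 by (simp add: sum_distrib_left mult_ac)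
      finally show ?thesis .
    qed
    \<comment> \<open>The exchanged selections are distinct: the value at \<open>i\<close> recovers
      \<open>r\<close>, and the other values recover \<open>g\<close> because
      \<open>g i = a\<close>. Hence their terms fit into the minor sum over \<open>J\<close> without
      repetition.\<close>
    have inj: "inj_on (\<lambda>(g, r). g(i := b r)) (X i \<times> {..<n})"
    proof (rule inj_onI)
      fix x y assume xy: "x \<in> X i \<times> {..<n}" "y \<in> X i \<times> {..<n}"
        "(\<lambda>(g, r). g(i := b r)) x = (\<lambda>(g, r). g(i := b r)) y"
      obtain g r g' r' where [simp]: "x = (g, r)" "y = (g', r')" by (cases x, cases y)
      from xy have g: "g \<in> X i" "g' \<in> X i" and r: "r \<in> {..<n}" "r' \<in> {..<n}"
        and eq: "g(i := b r) = g'(i := b r')" by auto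
      have "g j = g' j" for j
      proof (cases "j = i")
        case True
        then show ?thesis using g by (simp add: X_def)
      next
        case False
        then show ?thesis using fun_cong[OF eq, of j] by simp
      qed
      then have "g = g'" by blast
      moreover have "r = r'"
        using fun_cong[OF eq, of i] r by (intro inj_onD[OF binj]) simp_all
      ultimately show "x = y" by simp
    qed
    have "(\<Sum>g\<in>X i. ?T g) \<le> (\<Sum>g\<in>X i. W a * S * (\<Sum>r<n. ?T (g(i := b r))))"
      by (rule sum_mono) (rule T_le)
    also have "\<dots> = W a * S * (\<Sum>x\<in>(\<lambda>(g, r). g(i := b r)) ` (X i \<times> {..<n}). ?T x)"
    proof -
      have "(\<Sum>x\<in>(\<lambda>(g, r). g(i := b r)) ` (X i \<times> {..<n}). ?T x) =
          (\<Sum>(g, r)\<in>X i \<times> {..<n}. ?T (g(i := b r)))"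
        by (subst sum.reindex[OF inj], rule sum.cong) auto
      also have "\<dots> = (\<Sum>g\<in>X i. \<Sum>r<n. ?T (g(i := b r)))"
        by (simp only: sum.cartesian_product)
      finally show ?thesis by (simp only: sum_distrib_left)
    qed
    also have "\<dots> \<le> W a * S * minor_sum n W v J"
      unfolding minor_sum_def
    proof (intro mult_left_mono sum_mono2)
      show "(\<lambda>(g, r). g(i := b r)) ` (X i \<times> {..<n}) \<subseteq> ?G"
      proof (rule subsetI)
        fix x assume "x \<in> (\<lambda>(g, r). g(i := b r)) ` (X i \<times> {..<n})"
        then obtain g r where g: "g \<in> X i" and r: "r < n" and x: "x = g(i := b r)" by auto
        have "g j \<in> J" if "j < n" "j \<noteq> i" for j
          using g that unfolding X_def PiE_def Pi_def by auto
        moreover have "g j = undefined" if "\<not> j < n" for j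
          using g that unfolding X_def PiE_def extensional_def by auto
        ultimately show "x \<in> ?G"
          using bJ[OF r] i unfolding x PiE_def Pi_def extensional_def by auto
      qed
      show "0 \<le> ?T g" if "g \<in> ?G - (\<lambda>(g, r). g(i := b r)) ` (X i \<times> {..<n})" for g
        using that by (intro Tpos) auto
    qed (use finG' S W in auto)
    finally show ?thesis .
  qed
  have "minor_sum n W v (insert a J) = minor_sum n W v J + (\<Sum>g\<in>?G' - ?G. ?T g)"
    unfolding minor_sum_def using finG'
    by (subst sum.subset_diff[of ?G]) (auto intro: PiE_mono simp: PiE_def Pi_def)
  also have "(\<Sum>g\<in>?G' - ?G. ?T g) \<le> (\<Sum>g\<in>(\<Union>i\<in>?I. X i). ?T g)"
  proof -
    have "row_det n v g = 0" if g: "g \<in> ?G' - ?G" "g \<notin> (\<Union>i\<in>?I. X i)" for g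
    proof -
      obtain i where i: "i < n" "g i = a"
        using g(1) by (auto simp: PiE_def Pi_def)
      then have "g \<notin> X i" using g(2) by auto
      moreover have "g \<in> ?G'" using g(1) by (rule DiffD1)
      ultimately have "\<exists>j\<in>?I - {i}. g j = a"
        using i unfolding X_def by blast
      then obtain j where "j \<in> ?I - {i}" "g j = a" by (rule bexE)
      with i show ?thesis by (intro row_det_eq_0[of i n j]) simp_all
    qed
    then have "?T g = 0" if "g \<in> (?G' - ?G) - (?G' - ?G) \<inter> (\<Union>i\<in>?I. X i)" for g
    proof -
      from that have "g \<in> ?G' - ?G" "g \<notin> (\<Union>i\<in>?I. X i)" by blast+
      then have "row_det n v g = 0" by fact
      then show ?thesis by simp
    qed
    then have "(\<Sum>g\<in>?G' - ?G. ?T g) = (\<Sum>g\<in>(?G' - ?G) \<inter> (\<Union>i\<in>?I. X i). ?T g)"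
      by (intro sum.mono_neutral_right finite_Diff finG' Int_lower1 ballI)
    also have "\<dots> \<le> (\<Sum>g\<in>(\<Union>i\<in>?I. X i). ?T g)"
      using finG' by (intro sum_mono2 Tpos) (auto simp: X_def intro: finite_subset[of _ ?G'])
    finally show ?thesis .
  qed
  also have "\<dots> = (\<Sum>i\<in>?I. \<Sum>g\<in>X i. ?T g)"
    by (rule sum.UNION_disjoint) (use finG' in \<open>auto simp: X_def\<close>)
  also have "\<dots> \<le> (\<Sum>i\<in>?I. W a * S * minor_sum n W v J)"
    by (rule sum_mono) (use step in auto)
  finally show ?thesis by (simp add: S_def algebra_simps)
qed

section \<open>Interval matrices\<close>

text \<open>
  If two intervals start at 0, subtracting the shorter from the longer shortens the latter; otherwise
  the first column has at most one nonzero entry and can be expanded.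
\<close>
lemma det_interval_matrix:
  fixes lo hi :: "nat \<Rightarrow> nat"
  shows "det (mat n n (\<lambda>(i,j). if lo i \<le> j \<and> j < hi i then 1 else 0 :: int)) \<in> {-1, 0, 1}"
\<comment> \<open>Both moves lower this measure: a row subtraction shortens an interval, and a
  column expansion lowers \<open>n\<close> without lengthening any interval.\<close>
proof (induction "n + (\<Sum>i<n. hi i - lo i)" arbitrary: n lo hi rule: less_induct)
  case (less n lo hi)
  let ?A = "\<lambda>lo hi. mat n n (\<lambda>(i,j). if lo i \<le> j \<and> j < hi i then 1 else 0 :: int)"
  let ?S = "{i. i < n \<and> lo i = 0 \<and> 0 < hi i}"
  have carr: "?A lo hi \<in> carrier_mat n n" for lo hi by simp
  show ?case
  proof (cases "n = 0")
    case True
    then show ?thesis by simp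
  next
    case False
    show ?thesis
    proof (cases "\<exists>k\<in>?S. \<exists>l\<in>?S. k \<noteq> l")
      case True
      then obtain k' l' where kl': "k' \<in> ?S" "l' \<in> ?S" "k' \<noteq> l'" by blast
      obtain k l where kl: "k \<in> ?S" "l \<in> ?S" "k \<noteq> l" "hi l \<le> hi k"
      proof (cases "hi l' \<le> hi k'")
        case True
        then show ?thesis using that kl' by blast
      next
        case False
        then show ?thesis using that[OF kl'(2,1)] kl'(3) by simp
      qed
      \<comment> \<open>Removing \<open>[0, hi l)\<close> from \<open>[0, hi k)\<close> leaves the
        interval \<open>[hi l, hi k)\<close>, possibly empty.\<close>
      have "addrow (-1) k l (?A lo hi) = ?A (lo(k := hi l)) hi"
        by (rule eq_matI) (use kl in auto)
      then have "det (?A lo hi) = det (?A (lo(k := hi l)) hi)"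
        using det_addrow[OF _ kl(3) carr, of "-1" lo hi] kl(2) by (metis (lifting) mem_Collect_eq)
      moreover have "(\<Sum>i<n. hi i - (lo(k := hi l)) i) < (\<Sum>i<n. hi i - lo i)"
      proof (rule sum_strict_mono_ex1)
        show "\<exists>i\<in>{..<n}. hi i - (lo(k := hi l)) i < hi i - lo i"
          using kl by (intro bexI[of _ k]) simp_all
      qed (use kl in simp_all)
      then have "det (?A (lo(k := hi l)) hi) \<in> {-1, 0, 1}" by (intro less) simp
      ultimately show ?thesis by (simp only:)
    next
      case unique: False
      have exp: "det (?A lo hi) = (\<Sum>i<n. ?A lo hi $$ (i,0) * cofactor (?A lo hi) i 0)"
        using False by (intro laplace_expansion_column[OF carr]) auto
      show ?thesis
      proof (cases "?S = {}")
        case True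
        have "det (?A lo hi) = 0"
          unfolding exp using True False by (intro sum.neutral) auto
        then show ?thesis by simp
      next
        case False
        then obtain k where k: "k \<in> ?S" by blast
        define h where "h i = (if i < k then i else Suc i)" for i
        \<comment> \<open>\<open>h\<close> skips row \<open>k\<close>. Truncated subtraction is
          right here: an interval starting at 0 starts at 0 again once column 0 is gone, and an
          empty one stays empty.\<close>
        have minor: "mat_delete (?A lo hi) k 0 =
            mat (n - 1) (n - 1) (\<lambda>(i,j). if lo (h i) - 1 \<le> j \<and> j < hi (h i) - 1 then 1 else 0)"
          by (rule eq_matI) (use k in \<open>auto simp: mat_delete_def h_def\<close>)
        have "det (?A lo hi) = (\<Sum>i<n. if i = k then cofactor (?A lo hi) k 0 else 0)"
          unfolding exp
        proof (rule sum.cong[OF refl])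
          fix i assume "i \<in> {..<n}"
          moreover have "?A lo hi $$ (i, 0) = (if i = k then 1 else 0)" if "i < n"
          proof (cases "i = k")
            case False
            then have "i \<notin> ?S" using unique k by blast
            with that k False show ?thesis by simp
          qed (use that k in simp)
          ultimately show "?A lo hi $$ (i, 0) * cofactor (?A lo hi) i 0 =
              (if i = k then cofactor (?A lo hi) k 0 else 0)" by (simp del: index_mat)
        qed
        also have "\<dots> = cofactor (?A lo hi) k 0" using k by simp
        finally have expand: "det (?A lo hi) = (-1) ^ k * det (mat_delete (?A lo hi) k 0)"
          by (simp add: cofactor_def)
        have "(\<Sum>i<n - 1. (hi (h i) - 1) - (lo (h i) - 1)) \<le> (\<Sum>i<n - 1. hi (h i) - lo (h i))"
          by (intro sum_mono) simp
        also have "\<dots> = (\<Sum>i\<in>h ` {..<n - 1}. hi i - lo i)"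
          by (subst sum.reindex) (auto simp: inj_on_def h_def split: if_splits)
        also have "\<dots> \<le> (\<Sum>i<n. hi i - lo i)"
          by (intro sum_mono2) (auto simp: h_def split: if_splits)
        finally have "det (mat_delete (?A lo hi) k 0) \<in> {-1, 0, 1}"
          unfolding minor using k by (intro less add_less_le_mono) auto
        then show ?thesis unfolding expand by (cases "even k") auto
      qed
    qed
  qed
qed

lemma cong_det:
  fixes A B :: "int mat"
  assumes "A \<in> carrier_mat n n" "B \<in> carrier_mat n n"
    and "\<And>i j. i < n \<Longrightarrow> j < n \<Longrightarrow> [A $$ (i,j) = B $$ (i,j)] (mod m)"
  shows "[det A = det B] (mod m)"
  unfolding det_def'[OF assms(1)] det_def'[OF assms(2)]
  by (intro cong_sum cong_mult cong_prod cong_refl) (use assms(3) permutes_in_image in fastforce)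

text \<open>The determinants agree modulo 2 and the interval one lies in \<open>{-1, 0, 1}\<close>;
  if it is nonzero, the other one is odd and so has absolute value at least 1.\<close>

lemma abs_det_interval_matrix_le:
  fixes A :: "int mat" and lo hi :: "nat \<Rightarrow> nat"
  assumes "A \<in> carrier_mat n n"
    and "\<And>i j. i < n \<Longrightarrow> j < n \<Longrightarrow> odd (A $$ (i,j)) \<longleftrightarrow> lo i \<le> j \<and> j < hi i"
  shows "\<bar>det (mat n n (\<lambda>(i,j). if lo i \<le> j \<and> j < hi i then 1 else 0 :: int))\<bar> \<le> \<bar>det A\<bar>"
proof -
  let ?D = "mat n n (\<lambda>(i,j). if lo i \<le> j \<and> j < hi i then 1 else 0 :: int)"
  have "[det A = det ?D] (mod 2)"
  proof (rule cong_det[OF assms(1)])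
    fix i j assume "i < n" "j < n"
    then show "[A $$ (i, j) = ?D $$ (i, j)] (mod 2)"
      using assms(2)[of i j] by (simp add: cong_def mod2_eq_if)
  qed simp
  moreover have "det ?D \<in> {-1, 0, 1}" by (rule det_interval_matrix)
  moreover have "\<bar>d\<bar> \<le> \<bar>e\<bar>" if "d \<in> {-1, 0, 1}" "[e = d] (mod 2)" for d e :: int
  proof (cases "e = 0")
    case True
    with that(2) have "even d" by (metis cong_0_iff cong_sym)
    with that(1) True show ?thesis by auto
  qed (use that in auto)
  ultimately show ?thesis by simp
qed

section \<open>Circulant Gram matrices\<close>

text \<open>A coefficient vector shifted cyclically by \<open>l\<close>. Coefficients that land on
  the same position, as happens for \<open>N > m\<close>, are added.\<close>

definition circ_col :: "nat \<Rightarrow> nat \<Rightarrow> (nat \<Rightarrow> 'a::comm_ring_1) \<Rightarrow> nat \<Rightarrow> nat \<Rightarrow> 'a" where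
  "circ_col m N c l i = (\<Sum>j<N. if (l + j) mod m = i then c j else 0)"

text \<open>A shift that does not wrap around is supported in an interval; these are the shifts to
  which the parity comparison applies.\<close>

lemma circ_col_interval:
  assumes "l + N \<le> m"
  shows "circ_col m N c l i = (if l \<le> i \<and> i < l + N then c (i - l) else 0)"
proof -
  have "circ_col m N c l i = (\<Sum>j<N. if j = i - l then (if l \<le> i then c j else 0) else 0)"
    unfolding circ_col_def
  proof (rule sum.cong[OF refl])
    fix j assume "j \<in> {..<N}"
    then have "(l + j) mod m = l + j" using assms by simp
    then show "(if (l + j) mod m = i then c j else 0) =
        (if j = i - l then (if l \<le> i then c j else 0) else 0)" by auto
  qed
  also have "\<dots> = (if l \<le> i \<and> i < l + N then c (i - l) else 0)"
    by (auto simp: less_diff_conv2 not_less)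
  finally show ?thesis .
qed

lemma of_int_circ_col: "of_int (circ_col m N c l i) = circ_col m N (\<lambda>j. of_int (c j)) l i"
  unfolding circ_col_def of_int_sum by (intro sum.cong) auto

lemma of_real_circ_col: "of_real (circ_col m N c l i) = circ_col m N (\<lambda>j. of_real (c j)) l i"
  unfolding circ_col_def of_real_sum by (intro sum.cong) auto

lemma abs_circ_col_le:
  fixes c :: "nat \<Rightarrow> real"
  assumes "\<And>j. j < N \<Longrightarrow> \<bar>c j\<bar> \<le> 1"
  shows "\<bar>circ_col m N c l i\<bar> \<le> N"
proof -
  have "\<bar>circ_col m N c l i\<bar> \<le> (\<Sum>j<N. \<bar>if (l + j) mod m = i then c j else 0\<bar>)"
    unfolding circ_col_def by (rule sum_abs)
  also have "\<dots> \<le> (\<Sum>j<N. 1)" by (rule sum_mono) (use assms in auto)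
  finally show ?thesis by simp
qed

section \<open>Roots of unity and eigenvalues of circulant matrices\<close>

lemma power_mod_exp:
  fixes z :: "'a::monoid_mult"
  assumes "z ^ m = 1"
  shows "z ^ (n mod m) = z ^ n"
proof -
  have "z ^ n = z ^ (m * (n div m) + n mod m)" by simp
  also have "\<dots> = z ^ (n mod m)" unfolding power_add power_mult assms by simp
  finally show ?thesis ..
qed

text \<open>The entries of the shifted vector are the coefficients of \<open>z ^ l\<close> times the
  polynomial, reduced modulo \<open>z ^ m - 1\<close>; the reduction is invisible at an
  \<open>m\<close>-th root of unity.\<close>

lemma circ_col_eigen_right:
  fixes z :: "'a::comm_ring_1"
  assumes "z ^ m = 1" "m > 0"
  shows "(\<Sum>i<m. circ_col m N c l i * z ^ i) = z ^ l * (\<Sum>j<N. c j * z ^ j)"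
proof -
  have "(\<Sum>i<m. circ_col m N c l i * z ^ i) = (\<Sum>j<N. \<Sum>i<m. if i = (l + j) mod m then c j * z ^ i else 0)"
    unfolding circ_col_def sum_distrib_right
    by (subst sum.swap) (intro sum.cong refl, auto)
  also have "\<dots> = (\<Sum>j<N. c j * z ^ (l + j))"
    using assms by (simp add: power_mod_exp)
  finally show ?thesis by (simp add: sum_distrib_left power_add mult_ac)
qed

lemma card_mod_shift:
  fixes m :: nat
  assumes "i < m"
  shows "card {l. l < m \<and> (l + j) mod m = i} = 1"
proof -
  \<comment> \<open>\<open>m - j mod m\<close> represents \<open>- j\<close> modulo \<open>m\<close>
    while avoiding truncated subtraction.\<close>
  let ?l = "(i + (m - j mod m)) mod m"
  have jm: "j mod m \<le> m" using assms by (simp add: less_imp_le)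
  have "{l. l < m \<and> (l + j) mod m = i} = {?l}"
  proof (rule equalityI; rule subsetI)
    fix l assume "l \<in> {l. l < m \<and> (l + j) mod m = i}"
    then have l: "l < m" "i = (l + j) mod m" by auto
    have "?l = (l + j mod m + (m - j mod m)) mod m"
      unfolding l(2) by (simp only: mod_add_left_eq[of "l + j mod m", symmetric] mod_add_right_eq)
    also have "\<dots> = (l + m) mod m" by (simp only: add.assoc le_add_diff_inverse[OF jm])
    also have "\<dots> = l" using l(1) by simp
    finally show "l \<in> {?l}" by simp
  next
    fix l assume "l \<in> {?l}"
    then have l: "l = ?l" by simp
    have "(l + j) mod m = (i + (m - j mod m) + j mod m) mod m"
      unfolding l by (simp only: mod_add_left_eq mod_add_right_eq)
    also have "\<dots> = (i + m) mod m" by (simp only: add.assoc le_add_diff_inverse2[OF jm])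
    also have "\<dots> = i" using assms by simp
    finally show "l \<in> {l. l < m \<and> (l + j) mod m = i}" using l assms by simp
  qed
  then show ?thesis by simp
qed

text \<open>Here the sum runs over the shifts. For fixed \<open>i\<close> and \<open>j\<close>
  exactly one shift moves coefficient \<open>j\<close> to position \<open>i\<close>; it is congruent
  to \<open>i - j\<close>, whence the powers of the inverse \<open>y\<close> of
  \<open>z\<close>.\<close>

lemma circ_col_eigen_left:
  fixes z y :: "'a::comm_ring_1"
  assumes "z ^ m = 1" "z * y = 1" "i < m"
  shows "(\<Sum>l<m. circ_col m N c l i * z ^ l) = z ^ i * (\<Sum>j<N. c j * y ^ j)"
proof -
  have "(\<Sum>l<m. circ_col m N c l i * z ^ l) =
      (\<Sum>j<N. \<Sum>l<m. if (l + j) mod m = i then c j * z ^ l else 0)"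
    unfolding circ_col_def sum_distrib_right
    by (subst sum.swap) (intro sum.cong refl, auto)
  also have "\<dots> = (\<Sum>j<N. \<Sum>l<m. if (l + j) mod m = i then c j * (z ^ i * y ^ j) else 0)"
  proof (intro sum.cong refl)
    fix j l
    have "z ^ l = z ^ ((l + j) mod m) * y ^ j"
    proof -
      have "z ^ ((l + j) mod m) * y ^ j = z ^ l * (z * y) ^ j"
        by (simp add: power_mod_exp[OF assms(1)] power_add power_mult_distrib mult.assoc)
      then show ?thesis by (simp add: assms(2))
    qed
    then show "(if (l + j) mod m = i then c j * z ^ l else 0) =
        (if (l + j) mod m = i then c j * (z ^ i * y ^ j) else 0)" by auto
  qed
  also have "\<dots> = (\<Sum>j<N. c j * (z ^ i * y ^ j))"
  proof (rule sum.cong[OF refl])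
    fix j
    have "(\<Sum>l<m. if (l + j) mod m = i then c j * (z ^ i * y ^ j) else 0) =
        of_nat (card {l. l < m \<and> (l + j) mod m = i}) * (c j * (z ^ i * y ^ j))"
      by (subst sum.If_cases) (auto simp: Int_def)
    then show "(\<Sum>l<m. if (l + j) mod m = i then c j * (z ^ i * y ^ j) else 0) =
        c j * (z ^ i * y ^ j)" by (simp add: card_mod_shift[OF assms(3)])
  qed
  finally show ?thesis by (simp add: sum_distrib_left mult_ac)
qed

lemma sum_powers_unit_root:
  fixes z :: complex
  assumes "z ^ m = 1"
  shows "(\<Sum>i<m. z ^ i) = (if z = 1 then of_nat m else 0)"
  using assms by (cases "z = 1") (simp_all add: geometric_sum)

text \<open>The eigenvectors of powers of \<open>z r\<close> form the discrete Fourier matrix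
  \<open>?U\<close>. By orthogonality \<open>?V * ?U\<close> is \<open>m\<close> times the identity,
  so \<open>det ?U\<close> is nonzero and cancels from \<open>M * ?U = ?U * ?D\<close>.\<close>

lemma det_eq_prod_eigenvalues:
  fixes M :: "complex mat" and z :: "nat \<Rightarrow> complex"
  assumes M: "M \<in> carrier_mat m m" and "m > 0"
    and root: "\<And>r. r < m \<Longrightarrow> z r ^ m = 1" and norm: "\<And>r. r < m \<Longrightarrow> cmod (z r) = 1"
    and inj: "inj_on z {..<m}"
    and eig: "\<And>r i. r < m \<Longrightarrow> i < m \<Longrightarrow> (\<Sum>j<m. M $$ (i,j) * z r ^ j) = w r * z r ^ i"
  shows "det M = (\<Prod>r<m. w r)"
proof -
  let ?U = "mat m m (\<lambda>(i,r). z r ^ i)" and ?V = "mat m m (\<lambda>(r,i). cnj (z r) ^ i)"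
  let ?D = "mat m m (\<lambda>(i,j). if i = j then w i else 0)"
  let ?E = "mat m m (\<lambda>(i,j). if i = j then of_nat m else 0) :: complex mat"
  have UV: "?V * ?U = ?E"
  proof (rule eq_matI)
    fix r s assume "r < dim_row ?E" "s < dim_col ?E"
    then have r: "r < m" and s: "s < m" by simp_all
    have cnj: "z r * cnj (z r) = 1"
      using norm[OF r] complex_norm_square[of "z r"] by simp
    have eq1: "cnj (z r) * z s = 1 \<longleftrightarrow> r = s"
    proof
      assume "cnj (z r) * z s = 1"
      then have "z s = z r" using cnj by (metis mult.assoc mult.right_neutral mult.left_neutral)
      then show "r = s" using inj r s by (auto dest: inj_onD)
    qed (use cnj in \<open>simp add: mult.commute\<close>)
    have "(?V * ?U) $$ (r, s) = (\<Sum>i<m. (cnj (z r) * z s) ^ i)"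
      using r s by (simp add: scalar_prod_def power_mult_distrib atLeast0LessThan)
    also have "\<dots> = (if r = s then of_nat m else 0)"
      using root[OF r] root[OF s]
      by (subst sum_powers_unit_root)
        (simp_all add: eq1 power_mult_distrib complex_cnj_power[symmetric] del: complex_cnj_power)
    finally show "(?V * ?U) $$ (r, s) = ?E $$ (r, s)" using r s by simp
  qed simp_all
  have diag: "det (mat m m (\<lambda>(i,j). if i = j then d i else 0)) = (\<Prod>i<m. d i)" for d :: "nat \<Rightarrow> complex"
    by (subst det_upper_triangular[where n = m])
      (auto simp: upper_triangular_def diag_mat_def prod.list_conv_set_nth atLeast0LessThan)
  have "det ?V * det ?U = of_nat m ^ m"
    using diag[of "\<lambda>_. of_nat m"] UV by (subst det_mult[symmetric, where n = m]) simp_all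
  then have U0: "det ?U \<noteq> 0" using \<open>m > 0\<close> by auto
  have "M * ?U = ?U * ?D"
  proof (rule eq_matI)
    fix i r assume "i < dim_row (?U * ?D)" "r < dim_col (?U * ?D)"
    then have i: "i < m" and r: "r < m" by simp_all
    have "(M * ?U) $$ (i, r) = (\<Sum>j<m. M $$ (i,j) * z r ^ j)"
      using i r M by (simp add: scalar_prod_def atLeast0LessThan)
    also have "\<dots> = w r * z r ^ i" by (rule eig[OF r i])
    also have "\<dots> = (\<Sum>j<m. if j = r then z j ^ i * w r else 0)" using r by simp
    also have "\<dots> = (\<Sum>j<m. z j ^ i * (if j = r then w j else 0))"
      by (rule sum.cong) auto
    also have "\<dots> = (?U * ?D) $$ (i, r)"
      using i r by (simp add: scalar_prod_def atLeast0LessThan)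
    finally show "(M * ?U) $$ (i, r) = (?U * ?D) $$ (i, r)" .
  qed (use M in simp_all)
  then have "det M * det ?U = det ?U * det ?D"
    using M by (subst (1 2) det_mult[symmetric, where n = m]) simp_all
  then show ?thesis using U0 diag[of w] by simp
qed

text \<open>Apply the matrix to the powers of a root of unity \<open>z\<close>: summing over the
  entries produces the value of polynomial \<open>k\<close> at \<open>z\<close>, and summing over
  the shifts its value at \<open>cnj z\<close>. For real coefficients these are conjugate, so the
  eigenvalue is the weighted sum of squared moduli.\<close>

lemma det_circulant_gram:
  fixes c :: "'k \<Rightarrow> nat \<Rightarrow> real"
  assumes "finite A" "m > 0"
  shows "det (mat m m (\<lambda>(i,j). \<Sum>x\<in>A \<times> {..<m}. t (fst x) *
      circ_col m (N (fst x)) (c (fst x)) (snd x) i * circ_col m (N (fst x)) (c (fst x)) (snd x) j)) =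
    (\<Prod>r<m. \<Sum>k\<in>A. t k * (cmod (\<Sum>j<N k. of_real (c k j) * cis (2 * pi * real r / m) ^ j))\<^sup>2)"
proof -
  let ?M = "\<lambda>i j. \<Sum>x\<in>A \<times> {..<m}. t (fst x) *
      circ_col m (N (fst x)) (c (fst x)) (snd x) i * circ_col m (N (fst x)) (c (fst x)) (snd x) j"
  let ?w = "\<lambda>r::nat. \<Sum>k\<in>A. t k * (cmod (\<Sum>j<N k. of_real (c k j) * cis (2 * pi * r / m) ^ j))\<^sup>2"
  let ?z = "\<lambda>r::nat. cis (2 * pi * r / m)"
  let ?v = "\<lambda>k l i. circ_col m (N k) (\<lambda>j. of_real (c k j) :: complex) l i"
  let ?f = "\<lambda>k z. \<Sum>j<N k. of_real (c k j) * z ^ j :: complex"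
  have bij: "bij_betw ?z {..<m} {z. z ^ m = 1}" by (rule Complex.bij_betw_roots_unity[OF assms(2)])
  have root: "?z r ^ m = 1" if "r < m" for r using bij that unfolding bij_betw_def by blast
  have "complex_of_real (det (mat m m (\<lambda>(i,j). ?M i j))) = det (map_mat complex_of_real (mat m m (\<lambda>(i,j). ?M i j)))"
    by (rule of_real_hom.hom_det[symmetric])
  also have "\<dots> = (\<Prod>r<m. complex_of_real (?w r))"
  proof (rule det_eq_prod_eigenvalues[where z = ?z])
    show "inj_on ?z {..<m}" using bij by (rule bij_betw_imp_inj_on)
    fix r i assume r: "r < m" and i: "i < m"
    let ?Z = "?z r"
    have "(\<Sum>j<m. map_mat complex_of_real (mat m m (\<lambda>(i,j). ?M i j)) $$ (i,j) * ?Z ^ j) =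
        (\<Sum>j<m. \<Sum>x\<in>A \<times> {..<m}. of_real (t (fst x)) * ?v (fst x) (snd x) i * (?v (fst x) (snd x) j * ?Z ^ j))"
      using i by (intro sum.cong) (simp_all add: sum_distrib_right of_real_circ_col mult.assoc)
    also have "\<dots> = (\<Sum>x\<in>A \<times> {..<m}. of_real (t (fst x)) * ?v (fst x) (snd x) i * (\<Sum>j<m. ?v (fst x) (snd x) j * ?Z ^ j))"
      by (subst sum.swap) (simp only: sum_distrib_left)
    also have "\<dots> = (\<Sum>x\<in>A \<times> {..<m}. of_real (t (fst x)) * ?f (fst x) ?Z * (?v (fst x) (snd x) i * ?Z ^ snd x))"
      unfolding circ_col_eigen_right[OF root[OF r] assms(2)] by (simp only: mult_ac)
    also have "\<dots> = (\<Sum>k\<in>A. \<Sum>l<m. of_real (t k) * ?f k ?Z * (?v k l i * ?Z ^ l))"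
      by (simp only: sum.cartesian_product case_prod_unfold)
    also have "\<dots> = (\<Sum>k\<in>A. of_real (t k) * ?f k ?Z * (?Z ^ i * ?f k (cnj ?Z)))"
    proof (rule sum.cong[OF refl])
      fix k
      have "(\<Sum>l<m. ?v k l i * ?Z ^ l) = ?Z ^ i * ?f k (cnj ?Z)"
        by (rule circ_col_eigen_left[OF root[OF r] _ i]) (simp add: cis_cnj cis_mult)
      then show "(\<Sum>l<m. of_real (t k) * ?f k ?Z * (?v k l i * ?Z ^ l)) =
          of_real (t k) * ?f k ?Z * (?Z ^ i * ?f k (cnj ?Z))"
        by (simp only: sum_distrib_left[symmetric])
    qed
    also have "\<dots> = (\<Sum>k\<in>A. of_real (t k * (cmod (?f k ?Z))\<^sup>2) * ?Z ^ i)"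
    proof (rule sum.cong[OF refl])
      fix k
      have "?f k (cnj ?Z) = cnj (?f k ?Z)" by simp
      then have "complex_of_real ((cmod (?f k ?Z))\<^sup>2) = ?f k ?Z * ?f k (cnj ?Z)"
        by (simp only: complex_norm_square)
      then show "of_real (t k) * ?f k ?Z * (?Z ^ i * ?f k (cnj ?Z)) =
          of_real (t k * (cmod (?f k ?Z))\<^sup>2) * ?Z ^ i"
        by (simp only: of_real_mult mult_ac)
    qed
    also have "\<dots> = of_real (?w r) * ?Z ^ i" by (simp only: of_real_sum sum_distrib_right)
    finally show "(\<Sum>j<m. map_mat complex_of_real (mat m m (\<lambda>(i,j). ?M i j)) $$ (i,j) * ?Z ^ j) =
      of_real (?w r) * ?Z ^ i" .
  qed (use root assms in auto)
  also have "\<dots> = complex_of_real (\<Prod>r<m. ?w r)" by (simp only: of_real_prod)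
  finally show ?thesis by (simp only: of_real_eq_iff)
qed

section \<open>Comparison of the minors for the two coefficient families\<close>

lemma minor_sum_nonneg:
  assumes "\<And>c. c \<in> J \<Longrightarrow> W c \<ge> 0"
  shows "minor_sum n W v J \<ge> 0"
  unfolding minor_sum_def
  by (intro sum_nonneg mult_nonneg_nonneg prod_nonneg) (use assms in \<open>auto simp: PiE_def Pi_def\<close>)

text \<open>The vectors of \<open>R\<close> are inserted one at a time by
  \<open>minor_sum_insert_le\<close>; the unit vectors stay available in \<open>J\<close>, and each
  insertion costs one factor \<open>C\<close>.\<close>

lemma minor_sum_union_le:
  fixes W :: "'c \<Rightarrow> real"
  assumes "finite R" "finite J" "R \<inter> J = {}" and W: "\<And>c. c \<in> R \<union> J \<Longrightarrow> W c \<ge> 0"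
    and bJ: "\<And>r. r < n \<Longrightarrow> b r \<in> J" and Wb: "\<And>r. r < n \<Longrightarrow> W (b r) = 1"
    and unit: "\<And>r j. r < n \<Longrightarrow> j < n \<Longrightarrow> v (b r) j = (if j = r then 1 else 0)"
    and C: "\<And>a. a \<in> R \<Longrightarrow> 1 + n * W a * (\<Sum>r<n. (v a r)\<^sup>2) \<le> C"
  shows "minor_sum n W v (R \<union> J) \<le> C ^ card R * minor_sum n W v J"
  using assms(1,3) W C
proof (induction R rule: finite_induct)
  case empty
  then show ?case by simp
next
  case (insert a R)
  have IH: "minor_sum n W v (R \<union> J) \<le> C ^ card R * minor_sum n W v J"
    using insert.prems by (intro insert.IH) auto
  have W': "\<And>c. c \<in> insert a (R \<union> J) \<Longrightarrow> W c \<ge> 0" using insert.prems(2) by auto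
  have "minor_sum n W v (insert a R \<union> J) = minor_sum n W v (insert a (R \<union> J))" by simp
  also have "\<dots> \<le> (1 + n * W a * (\<Sum>r<n. (v a r)\<^sup>2)) * minor_sum n W v (R \<union> J)"
    by (rule minor_sum_insert_le[where b = b]) (use insert assms(2) bJ Wb unit W' in auto)
  also have "\<dots> \<le> C * minor_sum n W v (R \<union> J)"
    using insert.prems(3)[of a] W' by (intro mult_right_mono minor_sum_nonneg) auto
  also have "\<dots> \<le> C * (C ^ card R * minor_sum n W v J)"
  proof (rule mult_left_mono[OF IH])
    have "0 \<le> 1 + n * W a * (\<Sum>r<n. (v a r)\<^sup>2)"
      using W'[of a] by (intro add_nonneg_nonneg mult_nonneg_nonneg sum_nonneg) auto
    also have "\<dots> \<le> C" using insert.prems(3)[of a] by simp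
    finally show "0 \<le> C" .
  qed
  finally show ?case using insert.hyps by (simp add: mult.assoc)
qed

lemma row_det_of_int:
  "row_det n (\<lambda>c i. of_int (v c i)) g = (of_int (row_det n v g) :: 'a::comm_ring_1)"
  unfolding row_det_leibniz by simp

lemma minor_sum_mono_row_det:
  fixes v u :: "'c \<Rightarrow> nat \<Rightarrow> int"
  assumes "\<And>c. c \<in> J \<Longrightarrow> W c \<ge> 0"
    and "\<And>g. g \<in> {0..<n} \<rightarrow>\<^sub>E J \<Longrightarrow> \<bar>row_det n v g\<bar> \<le> \<bar>row_det n u g\<bar>"
  shows "minor_sum n W (\<lambda>c i. of_int (v c i)) J \<le> minor_sum n W (\<lambda>c i. of_int (u c i)) J"
  unfolding minor_sum_def row_det_of_int
proof (intro sum_mono mult_left_mono prod_nonneg ballI)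
  fix g assume g: "g \<in> {0..<n} \<rightarrow>\<^sub>E J"
  have "\<bar>real_of_int (row_det n v g)\<bar> \<le> \<bar>real_of_int (row_det n u g)\<bar>"
    using assms(2)[OF g] by linarith
  then show "(real_of_int (row_det n v g))\<^sup>2 \<le> (real_of_int (row_det n u g))\<^sup>2"
    by (simp only: abs_le_square_iff)
qed (use assms(1) in \<open>auto simp: PiE_def Pi_def\<close>)

text \<open>When no selected shift wraps around, the all-ones coefficients give an interval matrix,
  and the matrix for \<open>c\<close> has its odd entries exactly on the same intervals.\<close>

lemma abs_row_det_circ_col_le:
  fixes c :: "'k \<Rightarrow> nat \<Rightarrow> int"
  assumes odd: "\<And>k j. k \<in> A \<Longrightarrow> j < N k \<Longrightarrow> odd (c k j)"
    and g: "\<And>i. i < m \<Longrightarrow> fst (g i) \<in> A \<and> snd (g i) + N (fst (g i)) \<le> m"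
  shows "\<bar>row_det m (\<lambda>x. circ_col m (N (fst x)) (\<lambda>_. 1 :: int) (snd x)) g\<bar>
    \<le> \<bar>row_det m (\<lambda>x. circ_col m (N (fst x)) (c (fst x)) (snd x)) g\<bar>"
proof -
  let ?lo = "\<lambda>i. snd (g i)" and ?hi = "\<lambda>i. snd (g i) + N (fst (g i))"
  have "row_det m (\<lambda>x. circ_col m (N (fst x)) (\<lambda>_. 1 :: int) (snd x)) g =
      det (mat m m (\<lambda>(i,j). if ?lo i \<le> j \<and> j < ?hi i then 1 else 0))"
    unfolding row_det_def by (rule arg_cong[where f = det], rule eq_matI) (use g in \<open>simp_all add: circ_col_interval\<close>)
  also have "\<bar>\<dots>\<bar> \<le> \<bar>row_det m (\<lambda>x. circ_col m (N (fst x)) (c (fst x)) (snd x)) g\<bar>"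
    unfolding row_det_def
  proof (rule abs_det_interval_matrix_le)
    fix i j assume ij: "i < m" "j < m"
    have "j - ?lo i < N (fst (g i))" if "?lo i \<le> j" "j < ?hi i" using that by simp
    then show "odd (mat m m (\<lambda>(i,j). circ_col m (N (fst (g i))) (c (fst (g i))) (snd (g i)) j) $$ (i,j)) \<longleftrightarrow>
        ?lo i \<le> j \<and> j < ?hi i"
      using ij g[OF ij(1)] odd[of "fst (g i)" "j - ?lo i"] by (simp add: circ_col_interval)
  qed simp
  finally show ?thesis .
qed

text \<open>Both products are minor sums over all shifts \<open>J\<close>, up to the same factorial.
  For the all-ones family the wrapped shifts \<open>R\<close> are removed at the cost of
  \<open>C ^ card R\<close>; the rest is compared minor by minor; for \<open>c\<close> the shifts in
  \<open>R\<close> are put back for free, since this only adds nonnegative terms.\<close>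

lemma prod_circulant_eigenvalues_le:
  fixes c :: "'k \<Rightarrow> nat \<Rightarrow> int" and t :: "'k \<Rightarrow> real" and N :: "'k \<Rightarrow> nat" and A :: "'k set"
  defines "w \<equiv> \<lambda>c (m::nat) (r::nat). \<Sum>k\<in>A. t k * (cmod (\<Sum>j<N k. of_real (c k j) * cis (2 * pi * real r / m) ^ j))\<^sup>2"
  assumes A: "finite A" and m: "m > 0"
    and c: "\<And>k j. k \<in> A \<Longrightarrow> j < N k \<Longrightarrow> c k j \<in> {1, -1}"
    and t: "\<And>k. k \<in> A \<Longrightarrow> t k \<ge> 0"
    and Nm: "\<And>k. k \<in> A \<Longrightarrow> N k \<le> m"
    and a: "a \<in> A" "N a = 1" "t a = 1"
  shows "(\<Prod>r<m. w (\<lambda>_ _. 1) m r) \<le>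
    (1 + (real m)\<^sup>2 * (\<Sum>k\<in>A. t k * (real (N k))\<^sup>2)) ^ (\<Sum>k\<in>A. N k) *
    (\<Prod>r<m. w (\<lambda>k j. real_of_int (c k j)) m r)"
proof -
  let ?v = "\<lambda>(c :: 'k \<Rightarrow> nat \<Rightarrow> int) x. circ_col m (N (fst x)) (c (fst x)) (snd x)"
  let ?V = "\<lambda>(c :: 'k \<Rightarrow> nat \<Rightarrow> int) x i. real_of_int (?v c x i)"
  let ?W = "\<lambda>x. t (fst x)"
  let ?S = "\<lambda>c. minor_sum m ?W (?V c)"
  define J where "J = A \<times> {..<m}"
  define R where "R = {x \<in> J. m < snd x + N (fst x)}"
  \<comment> \<open>Bounds the factor required by \<open>minor_sum_union_le\<close>: a vector has
    \<open>m\<close> entries, each at most \<open>N k\<close> in absolute value, and the order of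
    the minors is \<open>m\<close> as well.\<close>
  define C where "C = 1 + (real m)\<^sup>2 * (\<Sum>k\<in>A. t k * (real (N k))\<^sup>2)"
  have fin: "finite J" "finite R" unfolding R_def J_def using A by auto
  have W: "?W x \<ge> 0" if "x \<in> J" for x using that t unfolding J_def by auto
  have C1: "C \<ge> 1" unfolding C_def using t by (simp add: sum_nonneg)
  have prod_eq: "(\<Prod>r<m. w (\<lambda>k j. real_of_int (c k j)) m r) = ?S c J / fact m" for c
    unfolding w_def det_circulant_gram[OF A m, symmetric] J_def of_int_circ_col
    by (rule det_gram_eq_minor_sum) (use A in simp)
  \<comment> \<open>A shift of polynomial \<open>k\<close> can wrap around only if it is among the
    last \<open>N k\<close> ones. The bound does not depend on \<open>m\<close>.\<close>
  have card_R: "card R \<le> (\<Sum>k\<in>A. N k)"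
  proof -
    have "R \<subseteq> (SIGMA k:A. {m - N k..<m})" unfolding R_def J_def by auto
    then have "card R \<le> card (SIGMA k:A. {m - N k..<m})" using A by (intro card_mono) auto
    also have "\<dots> = (\<Sum>k\<in>A. N k)" using A Nm by simp
    finally show ?thesis .
  qed
  have "R \<union> (J - R) = J" unfolding R_def by auto
  then have "?S (\<lambda>_ _. 1) J = ?S (\<lambda>_ _. 1) (R \<union> (J - R))" by (simp only:)
  also have "\<dots> \<le> C ^ card R * ?S (\<lambda>_ _. 1) (J - R)"
  \<comment> \<open>Polynomial \<open>a\<close> has length 1 and weight 1, so its shifts are the
    unit vectors, and none of them wraps around.\<close>
  proof (rule minor_sum_union_le[where b = "\<lambda>r. (a, r)"])
    fix x assume "x \<in> R"
    then have x: "x \<in> J" "fst x \<in> A" unfolding R_def J_def by auto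
    have "(\<Sum>r<m. (?V (\<lambda>_ _. 1) x r)\<^sup>2) \<le> (\<Sum>r<m. (real (N (fst x)))\<^sup>2)"
    proof (rule sum_mono)
      fix r
      have "\<bar>?V (\<lambda>_ _. 1) x r\<bar> \<le> \<bar>real (N (fst x))\<bar>"
        using abs_circ_col_le[of "N (fst x)" "\<lambda>_. 1" m "snd x" r] by (simp add: of_int_circ_col)
      then show "(?V (\<lambda>_ _. 1) x r)\<^sup>2 \<le> (real (N (fst x)))\<^sup>2" by (simp only: abs_le_square_iff)
    qed
    then have "m * ?W x * (\<Sum>r<m. (?V (\<lambda>_ _. 1) x r)\<^sup>2) \<le> m * ?W x * (m * (real (N (fst x)))\<^sup>2)"
      using W[OF x(1)] by (intro mult_left_mono) auto
    also have "\<dots> = (real m)\<^sup>2 * (t (fst x) * (real (N (fst x)))\<^sup>2)"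
      by (simp add: power2_eq_square)
    also have "\<dots> \<le> (real m)\<^sup>2 * (\<Sum>k\<in>A. t k * (real (N k))\<^sup>2)"
      using A x(2) t by (intro mult_left_mono member_le_sum) auto
    finally show "1 + m * ?W x * (\<Sum>r<m. (?V (\<lambda>_ _. 1) x r)\<^sup>2) \<le> C" unfolding C_def by simp
  next
    fix r j assume r: "r < m" "j < m"
    then show "?V (\<lambda>_ _. 1) (a, r) j = (if j = r then 1 else 0)"
      using circ_col_interval[of r 1 m "\<lambda>_. 1::int" j] a by auto
  qed (use fin a W in \<open>auto simp: R_def J_def\<close>)
  also have "\<dots> \<le> C ^ (\<Sum>k\<in>A. N k) * ?S c J"
  proof (rule mult_mono)
    show "C ^ card R \<le> C ^ (\<Sum>k\<in>A. N k)" by (rule power_increasing[OF card_R C1])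
    have "?S (\<lambda>_ _. 1) (J - R) \<le> ?S c (J - R)"
    proof (rule minor_sum_mono_row_det)
      fix g assume g: "g \<in> {0..<m} \<rightarrow>\<^sub>E J - R"
      show "\<bar>row_det m (?v (\<lambda>_ _. 1)) g\<bar> \<le> \<bar>row_det m (?v c) g\<bar>"
      proof (rule abs_row_det_circ_col_le[where A = A])
        show "odd (c k j)" if "k \<in> A" "j < N k" for k j using c[OF that] by (elim insertE) simp_all
        fix i assume "i < m"
        then have "g i \<in> J - R" using g by auto
        then show "fst (g i) \<in> A \<and> snd (g i) + N (fst (g i)) \<le> m"
          unfolding J_def R_def by auto
      qed
    qed (use W in auto)
    also have "\<dots> \<le> ?S c J" by (rule minor_sum_mono) (use fin W in auto)
    finally show "?S (\<lambda>_ _. 1) (J - R) \<le> ?S c J" .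
  qed (use C1 W in \<open>auto intro!: minor_sum_nonneg\<close>)
  finally have "?S (\<lambda>_ _. 1) J / fact m \<le> C ^ (\<Sum>k\<in>A. N k) * (?S c J / fact m)"
    by (simp add: divide_right_mono)
  moreover have "(\<Prod>r<m. w (\<lambda>_ _. 1) m r) = ?S (\<lambda>_ _. 1) J / fact m"
    using prod_eq[of "\<lambda>_ _. 1"] by simp
  ultimately show ?thesis unfolding prod_eq C_def by simp
qed

section \<open>The logarithmic integral\<close>

text \<open>Left endpoints are used because for \<open>T = 2 * pi\<close> they are the arguments of
  the \<open>m\<close>-th roots of unity. Uniform continuity bounds the error on each piece.\<close>

lemma riemann_sum_tendsto_integral:
  fixes h :: "real \<Rightarrow> real"
  assumes T: "T > 0" and h: "continuous_on {0..T} h"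
  shows "(\<lambda>m. T / real m * (\<Sum>r<m. h (T * real r / real m))) \<longlonglongrightarrow> integral {0..T} h"
proof (rule LIMSEQ_I)
  fix e :: real assume e: "e > 0"
  \<comment> \<open>The pieces have total length \<open>T\<close>, so the accumulated error is at
    most \<open>e' * T = e / 2\<close>.\<close>
  define e' where "e' = e / (2 * T)"
  have e': "e' > 0" using e T by (simp add: e'_def)
  have "uniformly_continuous_on {0..T} h"
    using h by (rule compact_uniformly_continuous) simp
  then obtain d where d: "d > 0"
    and close: "\<And>x y. x \<in> {0..T} \<Longrightarrow> y \<in> {0..T} \<Longrightarrow> dist y x < d \<Longrightarrow> dist (h y) (h x) < e'"
    unfolding uniformly_continuous_on_def using e' by metis
  obtain m0 :: nat where m0: "real m0 > T / d" using reals_Archimedean2 by blast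
  show "\<exists>no. \<forall>m\<ge>no. norm (T / real m * (\<Sum>r<m. h (T * real r / real m)) - integral {0..T} h) < e"
  proof (intro exI allI impI)
    fix m assume "m \<ge> Suc m0"
    then have m: "m > 0" "real m > T / d" using m0 by auto
    have Tm: "T / real m < d" using m d by (simp add: pos_divide_less_eq mult.commute)
    define X where "X r = T * real r / real m" for r
    have Tm0: "T / real m > 0" using T m by simp
    have X_Suc: "X (Suc r) = X r + T / m" for r
      unfolding X_def by (simp add: distrib_left add_divide_distrib)
    have X_0: "X 0 = 0" and X_m: "X m = T" using m unfolding X_def by simp_all
    have X_ge: "0 \<le> X r" for r unfolding X_def using T by simp
    have X_le: "X r \<le> T" if "r \<le> m" for r
    proof -
      have "T * real r \<le> T * real m" using that T by (intro mult_left_mono) auto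
      then show ?thesis using m unfolding X_def by (simp add: pos_divide_le_eq)
    qed
    have X_mono: "X r \<le> X (Suc r)" for r unfolding X_Suc using Tm0 by linarith
    have int: "h integrable_on {u..v}" if "0 \<le> u" "v \<le> T" for u v
    proof (rule integrable_continuous_interval, rule continuous_on_subset[OF h])
      show "{u..v} \<subseteq> {0..T}" using that by (simp add: atLeastatMost_subset_iff)
    qed
    have split: "integral {0..X k} h = (\<Sum>r<k. integral {X r..X (Suc r)} h)" if "k \<le> m" for k
      using that
    proof (induction k)
      case 0
      then show ?case by (simp add: X_0)
    next
      case (Suc k)
      have "integral {0..X k} h + integral {X k..X (Suc k)} h = integral {0..X (Suc k)} h"
        by (intro Henstock_Kurzweil_Integration.integral_combine X_ge X_mono int order_refl X_le Suc.prems)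
      then show ?case using Suc by (simp only: sum.lessThan_Suc Suc_leD)
    qed
    have piece: "\<bar>T / m * h (X r) - integral {X r..X (Suc r)} h\<bar> \<le> e' * (T / m)" if r: "r < m" for r
    proof -
      have Xr: "X (Suc r) \<le> T" using X_le r by simp
      have "norm (integral {X r..X (Suc r)} (\<lambda>y. h y - h (X r))) \<le> e' * (X (Suc r) - X r)"
      proof (rule integral_bound[OF X_mono])
        show "continuous_on {X r..X (Suc r)} (\<lambda>y. h y - h (X r))"
          using X_ge Xr by (intro continuous_intros continuous_on_subset[OF h]) (simp add: atLeastatMost_subset_iff)
        show "norm (h y - h (X r)) \<le> e'" if y: "y \<in> {X r..X (Suc r)}" for y
        proof -
          have "dist y (X r) < d" using y Tm unfolding X_Suc by (simp add: dist_real_def)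
          moreover have "X r \<in> {0..T}" "y \<in> {0..T}" using y X_ge[of r] Xr by auto
          ultimately have "dist (h y) (h (X r)) < e'" by (intro close)
          then show ?thesis by (simp add: dist_norm)
        qed
      qed
      moreover have "integral {X r..X (Suc r)} (\<lambda>y. h y - h (X r)) =
          integral {X r..X (Suc r)} h - T / m * h (X r)"
        using int[OF X_ge Xr, of r] X_mono[of r]
        by (subst integral_diff) (simp_all add: X_Suc integrable_const_ivl)
      ultimately show ?thesis unfolding X_Suc by (simp add: abs_minus_commute)
    qed
    have "integral {0..T} h = (\<Sum>r<m. integral {X r..X (Suc r)} h)"
      using split[OF order_refl] unfolding X_m .
    then have "T / m * (\<Sum>r<m. h (X r)) - integral {0..T} h =
        (\<Sum>r<m. T / m * h (X r) - integral {X r..X (Suc r)} h)"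
      by (simp only: sum_subtractf sum_distrib_left)
    also have "\<bar>\<dots>\<bar> \<le> (\<Sum>r<m. \<bar>T / m * h (X r) - integral {X r..X (Suc r)} h\<bar>)"
      by (rule sum_abs)
    also have "\<dots> \<le> (\<Sum>r<m. e' * (T / m))" by (rule sum_mono) (use piece in simp)
    also have "\<dots> = e / 2" using m T by (simp add: e'_def)
    also have "\<dots> < e" using e by simp
    finally show "norm (T / real m * (\<Sum>r<m. h (T * real r / real m)) - integral {0..T} h) < e"
      unfolding X_def by simp
  qed
qed

text \<open>Covers both functions of the overview: \<open>F\<close> has the given signs as
  coefficients, \<open>G\<close> has all coefficients equal to 1.\<close>

definition square_fun :: "'k set \<Rightarrow> ('k \<Rightarrow> real) \<Rightarrow> ('k \<Rightarrow> nat) \<Rightarrow> ('k \<Rightarrow> nat \<Rightarrow> real) \<Rightarrow> real \<Rightarrow> real" where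
  "square_fun A t N c \<theta> = (\<Sum>k\<in>A. t k * (cmod (\<Sum>j<N k. of_real (c k j) * cis \<theta> ^ j))\<^sup>2)"

lemma square_fun_nonneg:
  assumes "\<And>k. k \<in> A \<Longrightarrow> t k \<ge> 0"
  shows "square_fun A t N c \<theta> \<ge> 0"
  unfolding square_fun_def by (intro sum_nonneg mult_nonneg_nonneg) (use assms in auto)

lemma continuous_on_square_fun [continuous_intros]: "continuous_on S (square_fun A t N c)"
  unfolding square_fun_def[abs_def] by (intro continuous_intros)

lemma square_fun_scale: "square_fun A (\<lambda>k. s * t k) N c \<theta> = s * square_fun A t N c \<theta>"
  unfolding square_fun_def by (simp add: sum_distrib_left mult.assoc)

lemma prod_square_fun_le:
  fixes c :: "'k \<Rightarrow> nat \<Rightarrow> int" and t :: "'k \<Rightarrow> real" and N :: "'k \<Rightarrow> nat"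
  assumes A: "finite A" and m: "m > 0"
    and c: "\<And>k j. k \<in> A \<Longrightarrow> j < N k \<Longrightarrow> c k j \<in> {1, -1}"
    and t: "\<And>k. k \<in> A \<Longrightarrow> t k \<ge> 0"
    and Nm: "\<And>k. k \<in> A \<Longrightarrow> N k \<le> m"
  shows "(\<Prod>r<m. 1 + square_fun A t N (\<lambda>_ _. 1) (2 * pi * real r / m)) \<le>
    (1 + (real m)\<^sup>2 * (1 + (\<Sum>k\<in>A. t k * (real (N k))\<^sup>2))) ^ (1 + (\<Sum>k\<in>A. N k)) *
    (\<Prod>r<m. 1 + square_fun A t N (\<lambda>k j. of_int (c k j)) (2 * pi * real r / m))"
proof -
  \<comment> \<open>The summand 1 is the contribution of one additional polynomial, the constant 1.\<close>
  let ?A = "insert None (Some ` A)"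
  let ?t = "case_option 1 t" and ?N = "case_option 1 N" and ?c = "case_option (\<lambda>_. 1) c"
  have sum: "(\<Sum>k\<in>?A. F k) = F None + (\<Sum>k\<in>A. F (Some k))" for F :: "'k option \<Rightarrow> 'b::comm_monoid_add"
    using A by (subst sum.insert) (auto simp: sum.reindex)
  have "(\<Prod>r<m. \<Sum>k\<in>?A. ?t k * (cmod (\<Sum>j<?N k. of_real 1 * cis (2 * pi * real r / m) ^ j))\<^sup>2) \<le>
    (1 + (real m)\<^sup>2 * (\<Sum>k\<in>?A. ?t k * (real (?N k))\<^sup>2)) ^ (\<Sum>k\<in>?A. ?N k) *
    (\<Prod>r<m. \<Sum>k\<in>?A. ?t k * (cmod (\<Sum>j<?N k. of_real (real_of_int (?c k j)) * cis (2 * pi * real r / m) ^ j))\<^sup>2)"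
  \<comment> \<open>\<open>None\<close> has length 1 and weight 1, so it also supplies the unit
    vectors needed for removing wrapped shifts.\<close>
  proof (rule prod_circulant_eigenvalues_le[where a = None])
    fix k j assume "k \<in> ?A" "j < ?N k"
    then show "?c k j \<in> {1, -1}"
    proof (cases k)
      case (Some x)
      then have "x \<in> A" "j < N x" using \<open>k \<in> ?A\<close> \<open>j < ?N k\<close> by auto
      then show ?thesis using c[of x j] Some by simp
    qed simp
  qed (use A m t Nm in auto)
  then show ?thesis unfolding sum square_fun_def by simp
qed

lemma integral_ln_dirichlet_le:
  fixes c :: "'k \<Rightarrow> nat \<Rightarrow> int" and t :: "'k \<Rightarrow> real" and N :: "'k \<Rightarrow> nat"
  assumes A: "finite A"
    and c: "\<And>k j. k \<in> A \<Longrightarrow> j < N k \<Longrightarrow> c k j \<in> {1, -1}"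
    and t: "\<And>k. k \<in> A \<Longrightarrow> t k \<ge> 0"
  shows "integral {0..2*pi} (\<lambda>\<theta>. ln (1 + square_fun A t N (\<lambda>_ _. 1) \<theta>)) \<le>
    integral {0..2*pi} (\<lambda>\<theta>. ln (1 + square_fun A t N (\<lambda>k j. of_int (c k j)) \<theta>))"
proof -
  let ?G = "square_fun A t N (\<lambda>_ _. 1)" and ?F = "square_fun A t N (\<lambda>k j. of_int (c k j))"
  let ?R = "\<lambda>H (m::nat). 2 * pi / real m * (\<Sum>r<m. ln (1 + H (2 * pi * real r / real m)))"
  define B where "B = 1 + (\<Sum>k\<in>A. t k * (real (N k))\<^sup>2)"
  define q where "q = real (1 + (\<Sum>k\<in>A. N k))"
  have B: "B > 0" unfolding B_def using t by (intro add_pos_nonneg sum_nonneg) auto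
  have pos: "1 + square_fun A t N d \<theta> > 0" for d \<theta>
    using square_fun_nonneg[of A t N d \<theta>] t by (simp add: add_pos_nonneg)
  have ln_pos: "(\<Sum>r<m. ln (1 + square_fun A t N d (x r))) = ln (\<Prod>r<m. 1 + square_fun A t N d (x r))"
    for d m and x :: "nat \<Rightarrow> real"
    by (rule ln_prod[symmetric]) (simp_all add: pos pos[THEN less_imp_neq, symmetric])
  have lim: "?R (square_fun A t N d) \<longlonglongrightarrow> integral {0..2*pi} (\<lambda>\<theta>. ln (1 + square_fun A t N d \<theta>))" for d
  proof (rule riemann_sum_tendsto_integral)
    show "continuous_on {0..2*pi} (\<lambda>\<theta>. ln (1 + square_fun A t N d \<theta>))"
      by (intro continuous_intros ballI pos[THEN less_imp_neq, symmetric])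
  qed simp
  \<comment> \<open>The exponent \<open>q\<close> is independent of \<open>m\<close>, so the
    logarithm of the lost factor grows like \<open>ln m\<close> and disappears after division by
    \<open>m\<close>.\<close>
  have "(\<lambda>m. 2 * pi * q * (ln (1 + (real m)\<^sup>2 * B) / real m)) \<longlonglongrightarrow> 2 * pi * q * 0"
    using B by (intro tendsto_mult tendsto_const) real_asymp
  then have "(\<lambda>m. 2 * pi * q * (ln (1 + (real m)\<^sup>2 * B) / real m) + ?R ?F m) \<longlonglongrightarrow>
      2 * pi * q * 0 + integral {0..2*pi} (\<lambda>\<theta>. ln (1 + ?F \<theta>))"
    by (rule tendsto_add) (rule lim)
  moreover have "?R ?G m \<le> 2 * pi * q * (ln (1 + (real m)\<^sup>2 * B) / real m) + ?R ?F m"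
    if m: "m \<ge> Max (insert 1 (N ` A))" for m
  proof -
    have m0: "m > 0" and Nm: "\<And>k. k \<in> A \<Longrightarrow> N k \<le> m" using m A by auto
    have C: "1 + (real m)\<^sup>2 * B > 0" using B by (simp add: add_pos_nonneg)
    have "(\<Sum>r<m. ln (1 + ?G (2 * pi * real r / m))) = ln (\<Prod>r<m. 1 + ?G (2 * pi * real r / m))"
      by (rule ln_pos)
    also have "\<dots> \<le> ln ((1 + (real m)\<^sup>2 * B) ^ (1 + (\<Sum>k\<in>A. N k)) * (\<Prod>r<m. 1 + ?F (2 * pi * real r / m)))"
    proof (rule ln_mono)
      show "(\<Prod>r<m. 1 + ?G (2 * pi * real r / m)) \<le>
          (1 + (real m)\<^sup>2 * B) ^ (1 + (\<Sum>k\<in>A. N k)) * (\<Prod>r<m. 1 + ?F (2 * pi * real r / m))"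
        unfolding B_def by (rule prod_square_fun_le) (use A m0 c t Nm in blast)+
    qed (simp add: pos prod_pos)
    also have "\<dots> = q * ln (1 + (real m)\<^sup>2 * B) + (\<Sum>r<m. ln (1 + ?F (2 * pi * real r / m)))"
    proof -
      have "(1 + (real m)\<^sup>2 * B) ^ (1 + (\<Sum>k\<in>A. N k)) > 0" using C by (rule zero_less_power)
      moreover have "(\<Prod>r<m. 1 + ?F (2 * pi * real r / m)) > 0" by (simp add: pos prod_pos)
      ultimately show ?thesis unfolding ln_pos q_def ln_realpow[symmetric] by (rule ln_mult_pos)
    qed
    finally have "2 * pi / m * (\<Sum>r<m. ln (1 + ?G (2 * pi * real r / m))) \<le>
        2 * pi / m * (q * ln (1 + (real m)\<^sup>2 * B) + (\<Sum>r<m. ln (1 + ?F (2 * pi * real r / m))))"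
      by (intro mult_left_mono) simp_all
    then show ?thesis by (simp only: distrib_left mult_ac times_divide_eq_right times_divide_eq_left)
  qed
  ultimately show ?thesis
    using LIMSEQ_le[OF lim[of "\<lambda>_ _. 1"]] by auto
qed

section \<open>From logarithms to powers\<close>

text \<open>Taken in \<open>ennreal\<close>, so that substitution and exchange of integrals need no
  integrability; positivity and finiteness are shown separately for each kernel.\<close>

definition mellin_const :: "(real \<Rightarrow> real) \<Rightarrow> real \<Rightarrow> ennreal" where
  "mellin_const \<phi> q = (\<integral>\<^sup>+u. ennreal (indicator {0<..} u * (\<phi> u * u powr (- q - 1))) \<partial>lborel)"

text \<open>The substitution \<open>u = x * s\<close> extracts the power of
  \<open>x\<close>.\<close>

lemma nn_integral_mellin_scale:
  fixes \<phi> :: "real \<Rightarrow> real"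
  assumes [measurable]: "\<phi> \<in> borel_measurable borel" and "\<phi> 0 = 0" "x \<ge> 0"
  shows "(\<integral>\<^sup>+s. ennreal (indicator {0<..} s * (\<phi> (s * x) * s powr (- q - 1))) \<partial>lborel) =
    ennreal (x powr q) * mellin_const \<phi> q"
proof (cases "x = 0")
  \<comment> \<open>At \<open>x = 0\<close> the left side vanishes by \<open>\<phi> 0 = 0\<close>
    and the right side by \<open>0 powr q = 0\<close>; in \<open>ennreal\<close> this holds even for
    an infinite constant.\<close>
  case True
  then show ?thesis using assms by simp
next
  case False
  then have x: "x > 0" using assms by simp
  let ?f = "\<lambda>u. ennreal (indicator {0<..} u * (\<phi> u * u powr (- q - 1)))"
  let ?g = "\<lambda>s. ennreal (indicator {0<..} s * (\<phi> (s * x) * s powr (- q - 1)))"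
  have fg: "?f (0 + x * s) = ennreal (x powr (- q - 1)) * ?g s" for s
  proof (cases "s > 0")
    case True
    then have "indicator {0<..} (0 + x * s) * (\<phi> (0 + x * s) * (0 + x * s) powr (- q - 1)) =
        x powr (- q - 1) * (indicator {0<..} s * (\<phi> (s * x) * s powr (- q - 1)))"
      using x by (simp add: powr_mult mult_ac)
    then show ?thesis by (simp only: ennreal_mult'[OF powr_ge_zero])
  next
    case False
    then have "\<not> x * s > 0" using x by (simp add: zero_less_mult_iff)
    with False show ?thesis by simp
  qed
  have "mellin_const \<phi> q = ennreal \<bar>x\<bar> * (\<integral>\<^sup>+s. ?f (0 + x * s) \<partial>lborel)"
    unfolding mellin_const_def using x by (intro nn_integral_real_affine) measurable
  also have "\<dots> = ennreal x * (ennreal (x powr (- q - 1)) * (\<integral>\<^sup>+s. ?g s \<partial>lborel))"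
    unfolding fg using x by (subst nn_integral_cmult) auto
  finally have "ennreal (x powr q) * mellin_const \<phi> q =
      ennreal (x powr q * (x * x powr (- q - 1))) * (\<integral>\<^sup>+s. ?g s \<partial>lborel)"
    using x by (simp add: ennreal_mult mult.assoc)
  also have "x powr q * (x * x powr (- q - 1)) = 1"
  proof -
    have "x powr q * (x powr 1 * x powr (- q - 1)) = x powr (q + (1 + (- q - 1)))"
      by (simp only: powr_add)
    then show ?thesis using x by simp
  qed
  finally show ?thesis by simp
qed

text \<open>Order \<open>a > q\<close> at 0 and growth \<open>b < q\<close> at infinity leave
  \<open>u powr (a - q - 1)\<close> on \<open>{0..1}\<close> and \<open>u powr (b - q - 1)\<close>
  on \<open>{1..}\<close>, both integrable.\<close>

lemma mellin_const_finite:
  assumes le0: "\<And>u. 0 < u \<Longrightarrow> u \<le> 1 \<Longrightarrow> \<phi> u \<le> C * u powr a"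
    and le1: "\<And>u. 1 \<le> u \<Longrightarrow> \<phi> u \<le> C * u powr b"
    and "C \<ge> 0" "b < q" "q < a"
  shows "mellin_const \<phi> q < \<infinity>"
proof -
  let ?f = "\<lambda>u. indicator {0..1} u * (C * u powr (a - q - 1)) :: real"
  let ?g = "\<lambda>u. indicator {1..} u * (C * u powr (b - q - 1)) :: real"
  have "((\<lambda>u. C * u powr (a - q - 1)) has_integral C * (1 powr (a - q - 1 + 1) / (a - q - 1 + 1))) {0..1}"
    using assms by (intro has_integral_mult_right has_integral_powr_from_0) auto
  then have f: "(\<integral>\<^sup>+u. ennreal (?f u) \<partial>lborel) < \<infinity>"
    using \<open>C \<ge> 0\<close> by (subst nn_integral_has_integral_lebesgue) auto
  have "((\<lambda>u. C * u powr (b - q - 1)) has_integral C * (- (1 powr (b - q - 1 + 1)) / (b - q - 1 + 1))) {1..}"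
    using assms by (intro has_integral_mult_right has_integral_powr_to_inf) auto
  then have g: "(\<integral>\<^sup>+u. ennreal (?g u) \<partial>lborel) < \<infinity>"
    using \<open>C \<ge> 0\<close> by (subst nn_integral_has_integral_lebesgue) auto
  have "mellin_const \<phi> q \<le> (\<integral>\<^sup>+u. ennreal (?f u) + ennreal (?g u) \<partial>lborel)"
    unfolding mellin_const_def
  proof (rule nn_integral_mono)
    fix u :: real
    have "indicator {0<..} u * (\<phi> u * u powr (- q - 1)) \<le> ?f u + ?g u"
    proof (cases "u > 0")
      case u: True
      have split: "u powr (e - q - 1) = u powr e * u powr (- q - 1)" for e
        by (simp only: powr_add[symmetric] add_diff_eq add_uminus_conv_diff)
      show ?thesis
      proof (cases "u \<le> 1")
        case True
        have "\<phi> u * u powr (- q - 1) \<le> C * u powr (a - q - 1)"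
          using mult_right_mono[OF le0[OF u True], of "u powr (- q - 1)"] by (simp add: split mult.assoc)
        moreover have "?g u \<ge> 0" using \<open>C \<ge> 0\<close> by simp
        ultimately show ?thesis using u True by simp
      next
        case False
        have "\<phi> u * u powr (- q - 1) \<le> C * u powr (b - q - 1)"
          using mult_right_mono[OF le1, of u "u powr (- q - 1)"] False by (simp add: split mult.assoc)
        then show ?thesis using u False by simp
      qed
    qed (use \<open>C \<ge> 0\<close> in simp)
    then have "ennreal (indicator {0<..} u * (\<phi> u * u powr (- q - 1))) \<le> ennreal (?f u + ?g u)"
      by (rule ennreal_leI)
    also have "\<dots> = ennreal (?f u) + ennreal (?g u)"
      using \<open>C \<ge> 0\<close> by (intro ennreal_plus) auto
    finally show "ennreal (indicator {0<..} u * (\<phi> u * u powr (- q - 1))) \<le> ennreal (?f u) + ennreal (?g u)" .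
  qed
  also have "\<dots> = (\<integral>\<^sup>+u. ennreal (?f u) \<partial>lborel) + (\<integral>\<^sup>+u. ennreal (?g u) \<partial>lborel)"
    by (rule nn_integral_add) measurable
  also have "\<dots> < \<infinity>" using f g by (simp add: ennreal_add_less_top)
  finally show ?thesis .
qed

text \<open>The weight is decreasing and positive, so a lower bound for the kernel on
  \<open>{1..2}\<close> suffices.\<close>

lemma mellin_const_pos:
  assumes "d > 0" "\<And>u. 1 \<le> u \<Longrightarrow> u \<le> 2 \<Longrightarrow> \<phi> u \<ge> d" "q > 0"
  shows "mellin_const \<phi> q > 0"
proof -
  let ?e = "d * 2 powr (- q - 1)"
  have "(0::ennreal) < ennreal ?e" using assms(1) by simp
  also have "\<dots> = (\<integral>\<^sup>+u. ennreal ?e * indicator {1..2::real} u \<partial>lborel)"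
    by (subst nn_integral_cmult_indicator) auto
  also have "\<dots> \<le> mellin_const \<phi> q"
    unfolding mellin_const_def
  proof (rule nn_integral_mono)
    fix u :: real
    show "ennreal ?e * indicator {1..2} u \<le> ennreal (indicator {0<..} u * (\<phi> u * u powr (- q - 1)))"
    proof (cases "u \<in> {1..2}")
      case True
      then have "2 powr (- q - 1) \<le> u powr (- q - 1)"
        using assms(3) by (intro powr_mono2') auto
      then have "?e \<le> \<phi> u * u powr (- q - 1)"
        using assms(1) assms(2)[of u] True by (intro mult_mono) auto
      then show ?thesis using True by (simp add: ennreal_leI)
    qed simp
  qed
  finally show ?thesis .
qed

lemma nn_integral_continuous_interval:
  fixes h :: "real \<Rightarrow> real"
  assumes "continuous_on {a..b} h" "\<And>x. x \<in> {a..b} \<Longrightarrow> h x \<ge> 0"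
  shows "(\<integral>\<^sup>+x. ennreal (indicator {a..b} x * h x) \<partial>lborel) = ennreal (integral {a..b} h)"
  using assms by (intro nn_integral_has_integral_lebesgue integrable_integral integrable_continuous_interval) auto

text \<open>Integrate \<open>\<phi> (s * Z \<theta>) * s powr (- q - 1)\<close> over both variables.
  Integrating over \<open>s\<close> first gives the integral of \<open>Z \<theta> powr q\<close>
  times the Mellin constant; integrating over \<open>\<theta>\<close> first allows the comparison
  for each \<open>s\<close>. Tonelli equates the two.\<close>

lemma integral_powr_mono_of_kernel:
  fixes \<phi> X Y :: "real \<Rightarrow> real"
  assumes \<phi>: "continuous_on {0..} \<phi>" "\<phi> 0 = 0" "\<And>u. u \<ge> 0 \<Longrightarrow> \<phi> u \<ge> 0" and \<phi>m: "\<phi> \<in> borel_measurable borel"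
    and q: "q > 0" and const: "0 < mellin_const \<phi> q" "mellin_const \<phi> q < \<infinity>"
    and X: "continuous_on UNIV X" "\<And>\<theta>. X \<theta> \<ge> 0" and Y: "continuous_on UNIV Y" "\<And>\<theta>. Y \<theta> \<ge> 0"
    and le: "\<And>s. s > 0 \<Longrightarrow> integral {a..b} (\<lambda>\<theta>. \<phi> (s * X \<theta>)) \<le> integral {a..b} (\<lambda>\<theta>. \<phi> (s * Y \<theta>))"
  shows "integral {a..b} (\<lambda>\<theta>. X \<theta> powr q) \<le> integral {a..b} (\<lambda>\<theta>. Y \<theta> powr q)"
proof -
  let ?K = "\<lambda>Z s \<theta>. ennreal (indicator {a..b} \<theta> * (indicator {0<..} s * (\<phi> (s * Z \<theta>) * s powr (- q - 1))))"
  have cont: "continuous_on {a..b} (\<lambda>\<theta>. Z \<theta> powr q)" "0 \<le> integral {a..b} (\<lambda>\<theta>. Z \<theta> powr q)"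
    if "continuous_on UNIV Z" "\<And>\<theta>. Z \<theta> \<ge> 0" for Z
  proof -
    show c: "continuous_on {a..b} (\<lambda>\<theta>. Z \<theta> powr q)"
      by (intro continuous_on_powr' continuous_on_const continuous_on_subset[OF that(1)]) (use that q in auto)
    show "0 \<le> integral {a..b} (\<lambda>\<theta>. Z \<theta> powr q)"
      by (intro integral_nonneg integrable_continuous_interval c) auto
  qed
  have mellin: "(\<integral>\<^sup>+s. \<integral>\<^sup>+\<theta>. ?K Z s \<theta> \<partial>lborel \<partial>lborel) =
      ennreal (integral {a..b} (\<lambda>\<theta>. Z \<theta> powr q)) * mellin_const \<phi> q"
    if Z: "continuous_on UNIV Z" "\<And>\<theta>. Z \<theta> \<ge> 0" for Z
  proof -
    note [measurable] = \<phi>m borel_measurable_continuous_onI[OF Z(1)]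
    have "(\<integral>\<^sup>+s. \<integral>\<^sup>+\<theta>. ?K Z s \<theta> \<partial>lborel \<partial>lborel) = (\<integral>\<^sup>+\<theta>. \<integral>\<^sup>+s. ?K Z s \<theta> \<partial>lborel \<partial>lborel)"
      by (rule lborel_pair.Fubini'[symmetric]) measurable
    also have "\<dots> = (\<integral>\<^sup>+\<theta>. ennreal (indicator {a..b} \<theta> * Z \<theta> powr q) * mellin_const \<phi> q \<partial>lborel)"
    proof (rule nn_integral_cong)
      fix \<theta>
      have "(\<integral>\<^sup>+s. ?K Z s \<theta> \<partial>lborel) = ennreal (indicator {a..b} \<theta>) *
          (\<integral>\<^sup>+s. ennreal (indicator {0<..} s * (\<phi> (s * Z \<theta>) * s powr (- q - 1))) \<partial>lborel)"
        by (subst nn_integral_cmult[symmetric]) (simp_all add: ennreal_mult')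
      also have "\<dots> = ennreal (indicator {a..b} \<theta>) * (ennreal (Z \<theta> powr q) * mellin_const \<phi> q)"
        by (subst nn_integral_mellin_scale[OF \<phi>m \<phi>(2) Z(2)]) (rule refl)
      finally show "(\<integral>\<^sup>+s. ?K Z s \<theta> \<partial>lborel) = ennreal (indicator {a..b} \<theta> * Z \<theta> powr q) * mellin_const \<phi> q"
        by (simp add: ennreal_mult' mult.assoc)
    qed
    also have "\<dots> = (\<integral>\<^sup>+\<theta>. ennreal (indicator {a..b} \<theta> * Z \<theta> powr q) \<partial>lborel) * mellin_const \<phi> q"
      by (rule nn_integral_multc) measurable
    also have "(\<integral>\<^sup>+\<theta>. ennreal (indicator {a..b} \<theta> * Z \<theta> powr q) \<partial>lborel) = ennreal (integral {a..b} (\<lambda>\<theta>. Z \<theta> powr q))"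
      by (rule nn_integral_continuous_interval[OF cont(1)[OF Z]]) simp
    finally show ?thesis .
  qed
  have inner: "(\<integral>\<^sup>+\<theta>. ?K Z s \<theta> \<partial>lborel) =
      ennreal (integral {a..b} (\<lambda>\<theta>. \<phi> (s * Z \<theta>))) * ennreal (s powr (- q - 1))"
    if s: "s > 0" and Z: "continuous_on UNIV Z" "\<And>\<theta>. Z \<theta> \<ge> 0" for s Z
  proof -
    note [measurable] = \<phi>m borel_measurable_continuous_onI[OF Z(1)]
    have sZ: "0 \<le> s * Z \<theta>" for \<theta> using s Z(2)[of \<theta>] by simp
    have c: "continuous_on {a..b} (\<lambda>\<theta>. \<phi> (s * Z \<theta>))"
      by (rule continuous_on_compose2[OF \<phi>(1)])
        (use sZ in \<open>auto intro!: continuous_intros continuous_on_subset[OF Z(1)]\<close>)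
    have "(\<integral>\<^sup>+\<theta>. ?K Z s \<theta> \<partial>lborel) =
        (\<integral>\<^sup>+\<theta>. ennreal (indicator {a..b} \<theta> * \<phi> (s * Z \<theta>)) * ennreal (s powr (- q - 1)) \<partial>lborel)"
      using s \<phi>(3)[OF sZ] by (intro nn_integral_cong) (simp add: ennreal_mult[symmetric] mult.assoc)
    also have "\<dots> = (\<integral>\<^sup>+\<theta>. ennreal (indicator {a..b} \<theta> * \<phi> (s * Z \<theta>)) \<partial>lborel) * ennreal (s powr (- q - 1))"
      by (rule nn_integral_multc) measurable
    also have "(\<integral>\<^sup>+\<theta>. ennreal (indicator {a..b} \<theta> * \<phi> (s * Z \<theta>)) \<partial>lborel) =
        ennreal (integral {a..b} (\<lambda>\<theta>. \<phi> (s * Z \<theta>)))"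
      by (rule nn_integral_continuous_interval[OF c]) (rule \<phi>(3)[OF sZ])
    finally show ?thesis .
  qed
  have "(\<integral>\<^sup>+s. \<integral>\<^sup>+\<theta>. ?K X s \<theta> \<partial>lborel \<partial>lborel) \<le> (\<integral>\<^sup>+s. \<integral>\<^sup>+\<theta>. ?K Y s \<theta> \<partial>lborel \<partial>lborel)"
  proof (rule nn_integral_mono)
    fix s :: real
    show "(\<integral>\<^sup>+\<theta>. ?K X s \<theta> \<partial>lborel) \<le> (\<integral>\<^sup>+\<theta>. ?K Y s \<theta> \<partial>lborel)"
    proof (cases "s > 0")
      case True
      show ?thesis
        unfolding inner[OF True X] inner[OF True Y] by (intro mult_right_mono ennreal_leI le True) simp
    qed simp
  qed
  then have "ennreal (integral {a..b} (\<lambda>\<theta>. X \<theta> powr q)) * mellin_const \<phi> q \<le>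
      ennreal (integral {a..b} (\<lambda>\<theta>. Y \<theta> powr q)) * mellin_const \<phi> q"
    unfolding mellin[OF X] mellin[OF Y] .
  \<comment> \<open>Being positive and finite, the Mellin constant is a positive real and can be
    cancelled.\<close>
  moreover obtain r where r: "mellin_const \<phi> q = ennreal r" "r > 0"
    using const by (cases "mellin_const \<phi> q") auto
  ultimately have "ennreal (integral {a..b} (\<lambda>\<theta>. X \<theta> powr q) * r) \<le> ennreal (integral {a..b} (\<lambda>\<theta>. Y \<theta> powr q) * r)"
    using cont(2)[OF X] cont(2)[OF Y] by (simp add: ennreal_mult)
  then have "integral {a..b} (\<lambda>\<theta>. X \<theta> powr q) * r \<le> integral {a..b} (\<lambda>\<theta>. Y \<theta> powr q) * r"
    using cont(2)[OF Y] r by (subst (asm) ennreal_le_iff) auto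
  then show ?thesis using r by simp
qed

section \<open>The two logarithmic kernels and their Mellin constants\<close>

text \<open>The difference vanishes at 0 and has derivative \<open>x\<^sup>2 / (1 + x)\<close>. The
  bound serves twice: for the order 2 of \<open>u - ln (1 + u)\<close> at 0, and as one half of the
  expansion used for \<open>q = 2\<close>.\<close>

lemma ln_one_plus_ge_quadratic:
  fixes x :: real
  assumes "x \<ge> 0"
  shows "x - x\<^sup>2 / 2 \<le> ln (1 + x)"
proof -
  let ?g = "\<lambda>x. ln (1 + x) - (x - x\<^sup>2 / 2) :: real"
  have "?g 0 \<le> ?g x"
  proof (rule DERIV_nonneg_imp_nondecreasing[OF assms])
    fix y :: real assume y: "0 \<le> y" "y \<le> x"
    have "(?g has_real_derivative 1 / (1 + y) - (1 - y)) (at y)"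
      using y by (auto intro!: derivative_eq_intros)
    moreover have "1 / (1 + y) - (1 - y) = y\<^sup>2 / (1 + y)"
      using y by (simp add: field_simps power2_eq_square)
    ultimately have "(?g has_real_derivative y\<^sup>2 / (1 + y)) (at y)" by (simp only:)
    moreover have "0 \<le> y\<^sup>2 / (1 + y)" using y by simp
    ultimately show "\<exists>d. (?g has_real_derivative d) (at y) \<and> 0 \<le> d" by blast
  qed
  then show ?thesis by simp
qed

text \<open>One order further, with derivative \<open>x ^ 3 / (1 + x)\<close> of the difference;
  this is the other half of the expansion.\<close>

lemma ln_one_plus_le_cubic:
  fixes x :: real
  assumes "x \<ge> 0"
  shows "ln (1 + x) \<le> x - x\<^sup>2 / 2 + x ^ 3 / 3"
proof -
  let ?g = "\<lambda>x. x - x\<^sup>2 / 2 + x ^ 3 / 3 - ln (1 + x) :: real"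
  have "?g 0 \<le> ?g x"
  proof (rule DERIV_nonneg_imp_nondecreasing[OF assms])
    fix y :: real assume y: "0 \<le> y" "y \<le> x"
    have "(?g has_real_derivative 1 - y + y\<^sup>2 - 1 / (1 + y)) (at y)"
      using y by (auto intro!: derivative_eq_intros)
    moreover have "1 - y + y\<^sup>2 - 1 / (1 + y) = y ^ 3 / (1 + y)"
    proof -
      have "(1 - y + y\<^sup>2) * (1 + y) = 1 + y ^ 3"
        by (simp add: power2_eq_square power3_eq_cube algebra_simps)
      then have "1 - y + y\<^sup>2 = (1 + y ^ 3) / (1 + y)" using y by (subst eq_divide_eq) auto
      then show ?thesis by (simp add: add_divide_distrib)
    qed
    ultimately have "(?g has_real_derivative y ^ 3 / (1 + y)) (at y)" by (simp only:)
    moreover have "0 \<le> y ^ 3 / (1 + y)" using y by simp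
    ultimately show "\<exists>d. (?g has_real_derivative d) (at y) \<and> 0 \<le> d" by blast
  qed
  then show ?thesis by simp
qed

lemma mellin_const_ln:
  assumes q: "0 < q" "q < 1"
  shows "0 < mellin_const (\<lambda>u. ln (1 + u)) q" "mellin_const (\<lambda>u. ln (1 + u)) q < \<infinity>"
proof -
  show "0 < mellin_const (\<lambda>u. ln (1 + u)) q"
    by (rule mellin_const_pos[where d = "ln 2"]) (use q in auto)
  \<comment> \<open>Serves both ranges: 1 comes from \<open>ln (1 + u) \<le> u\<close> near 0, the
    other value from \<open>ln_powr_bound\<close> together with
    \<open>1 + u \<le> 2 * u\<close>.\<close>
  let ?C = "max 1 (2 powr (q / 2) / (q / 2))"
  show "mellin_const (\<lambda>u. ln (1 + u)) q < \<infinity>"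
  proof (rule mellin_const_finite[where a = 1 and b = "q / 2" and C = ?C])
    fix u :: real assume u: "0 < u" "u \<le> 1"
    have "ln (1 + u) \<le> 1 * u" using ln_add_one_self_le_self[of u] u by simp
    also have "\<dots> \<le> ?C * u" using u by (intro mult_right_mono) auto
    finally show "ln (1 + u) \<le> ?C * u powr 1" using u by simp
  next
    fix u :: real assume u: "1 \<le> u"
    have "ln (1 + u) \<le> (1 + u) powr (q / 2) / (q / 2)" using u q by (intro ln_powr_bound) auto
    also have "\<dots> \<le> (2 * u) powr (q / 2) / (q / 2)"
      using u q by (intro divide_right_mono powr_mono2) auto
    also have "\<dots> = 2 powr (q / 2) / (q / 2) * u powr (q / 2)" using u by (simp add: powr_mult)
    also have "\<dots> \<le> ?C * u powr (q / 2)" by (intro mult_right_mono) auto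
    finally show "ln (1 + u) \<le> ?C * u powr (q / 2)" .
  qed (use q in auto)
qed

text \<open>Removing the linear term raises the order at 0 to 2 at the price of linear growth, which
  moves the admissible exponents to \<open>1 < q < 2\<close>.\<close>

lemma mellin_const_diff_ln:
  assumes q: "1 < q" "q < 2"
  shows "0 < mellin_const (\<lambda>u. u - ln (1 + u)) q" "mellin_const (\<lambda>u. u - ln (1 + u)) q < \<infinity>"
proof -
  show "0 < mellin_const (\<lambda>u. u - ln (1 + u)) q"
  \<comment> \<open>\<open>1 - ln 2\<close> is the value of the kernel at \<open>u = 1\<close>;
    bounding \<open>ln\<close> by its tangent at 2 shows that the kernel stays above it.\<close>
  proof (rule mellin_const_pos[where d = "1 - ln 2"])
    show "0 < 1 - ln (2::real)" using ln_2_less_1 by simp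
    fix u :: real assume u: "1 \<le> u" "u \<le> 2"
    have "ln (1 + u) = ln 2 + ln ((1 + u) / 2)" using u by (simp add: ln_div)
    also have "\<dots> \<le> ln 2 + ((1 + u) / 2 - 1)" using u by (intro add_left_mono ln_le_minus_one) simp
    finally have "ln (1 + u) \<le> ln 2 + ((1 + u) / 2 - 1)" .
    moreover have "1 \<le> (1 + u) / 2" using u by simp
    ultimately show "1 - ln 2 \<le> u - ln (1 + u)" by argo
  qed (use q in auto)
  show "mellin_const (\<lambda>u. u - ln (1 + u)) q < \<infinity>"
  proof (rule mellin_const_finite[where a = 2 and b = 1 and C = 1])
    fix u :: real assume u: "0 < u" "u \<le> 1"
    then have "u - ln (1 + u) \<le> u\<^sup>2"
      using ln_one_plus_ge_quadratic[of u] zero_le_power2[of u] by linarith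
    with u show "u - ln (1 + u) \<le> 1 * u powr 2" by simp
  next
    fix u :: real assume "1 \<le> u"
    then show "u - ln (1 + u) \<le> 1 * u powr 1" by simp
  qed (use q in auto)
qed

section \<open>First and second moments, and the power inequalities\<close>

lemma has_integral_cos_nat_diff:
  fixes j l :: nat
  shows "((\<lambda>\<theta>. cos ((real j - real l) * \<theta>)) has_integral (if j = l then 2 * pi else 0)) {0..2*pi}"
proof (cases "j = l")
  case True
  then show ?thesis using has_integral_const_real[of "1::real" 0 "2*pi"] by simp
next
  case False
  define k where "k = real j - real l"
  have k: "k \<noteq> 0" "k \<in> \<int>" using False unfolding k_def by auto
  have "((\<lambda>\<theta>. cos (k * \<theta>)) has_integral (sin (k * (2 * pi)) / k - sin (k * 0) / k)) {0..2*pi}"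
  proof (rule fundamental_theorem_of_calculus)
    fix x
    have "((\<lambda>\<theta>. sin (k * \<theta>) / k) has_real_derivative cos (k * x)) (at x within {0..2*pi})"
      using k by (auto intro!: derivative_eq_intros)
    then show "((\<lambda>\<theta>. sin (k * \<theta>) / k) has_vector_derivative cos (k * x)) (at x within {0..2*pi})"
      by (simp add: has_real_derivative_iff_has_vector_derivative)
  qed simp
  moreover have "sin (k * (2 * pi)) = 0"
    using sin_integer_2pi[OF k(2)] by (simp add: mult_ac)
  ultimately show ?thesis using False by (simp add: k_def)
qed

lemma cmod_trig_poly_square:
  fixes c :: "nat \<Rightarrow> real"
  shows "(cmod (\<Sum>j<n. of_real (c j) * cis \<theta> ^ j))\<^sup>2 =
    (\<Sum>j<n. \<Sum>l<n. c j * c l * cos ((real j - real l) * \<theta>))"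
proof -
  let ?z = "\<Sum>j<n. of_real (c j) * cis \<theta> ^ j"
  have "complex_of_real ((cmod ?z)\<^sup>2) = ?z * cnj ?z" by (rule complex_norm_square)
  also have "cnj ?z = (\<Sum>l<n. of_real (c l) * cis (- (real l * \<theta>)))"
    by (simp add: Complex.DeMoivre cis_cnj)
  also have "?z * \<dots> = (\<Sum>j<n. \<Sum>l<n. of_real (c j * c l) * cis ((real j - real l) * \<theta>))"
    unfolding sum_product
  proof (intro sum.cong refl)
    fix j l
    have "cis (real j * \<theta>) * cis (- (real l * \<theta>)) = cis ((real j - real l) * \<theta>)"
      by (simp add: cis_mult left_diff_distrib)
    then show "of_real (c j) * cis \<theta> ^ j * (of_real (c l) * cis (- (real l * \<theta>))) =
        of_real (c j * c l) * cis ((real j - real l) * \<theta>)"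
      by (simp add: Complex.DeMoivre mult_ac)
  qed
  finally have "(cmod ?z)\<^sup>2 = Re (\<Sum>j<n. \<Sum>l<n. of_real (c j * c l) * cis ((real j - real l) * \<theta>))"
    by (metis Re_complex_of_real)
  then show ?thesis by simp
qed

text \<open>Parseval: only the squares of the coefficients enter, so every choice of signs gives the
  same integral.\<close>

lemma has_integral_square_fun:
  assumes "finite A"
  shows "(square_fun A t N c has_integral (\<Sum>k\<in>A. t k * (2 * pi * (\<Sum>j<N k. (c k j)\<^sup>2)))) {0..2*pi}"
  unfolding square_fun_def[abs_def]
proof (intro has_integral_sum assms has_integral_mult_right)
  fix k
  have "((\<lambda>\<theta>. \<Sum>j<N k. \<Sum>l<N k. c k j * c k l * cos ((real j - real l) * \<theta>)) has_integral
      (\<Sum>j<N k. \<Sum>l<N k. c k j * c k l * (if j = l then 2 * pi else 0))) {0..2*pi}"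
    by (intro has_integral_sum has_integral_mult_right has_integral_cos_nat_diff) auto
  moreover have "(\<Sum>j<N k. \<Sum>l<N k. c k j * c k l * (if j = l then 2 * pi else 0)) =
      2 * pi * (\<Sum>j<N k. (c k j)\<^sup>2)"
  proof -
    have "(\<Sum>l<N k. c k j * c k l * (if j = l then 2 * pi else 0)) = 2 * pi * (c k j)\<^sup>2" if "j < N k" for j
    proof -
      have "(\<Sum>l<N k. c k j * c k l * (if j = l then 2 * pi else 0)) =
          (\<Sum>l<N k. if j = l then c k j * c k l * (2 * pi) else 0)"
        by (rule sum.cong) auto
      then show ?thesis using that by (simp add: power2_eq_square)
    qed
    then show ?thesis unfolding sum_distrib_left by (intro sum.cong refl) simp
  qed
  ultimately show "((\<lambda>\<theta>. (cmod (\<Sum>j<N k. of_real (c k j) * cis \<theta> ^ j))\<^sup>2) has_integral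
      2 * pi * (\<Sum>j<N k. (c k j)\<^sup>2)) {0..2*pi}"
    unfolding cmod_trig_poly_square by (simp only:)
qed

text \<open>At exponent 2 the Mellin constant of \<open>u - ln (1 + u)\<close> diverges at 0.
  Instead the terms of order \<open>s\<^sup>2\<close> are compared, since the kernel lies between
  \<open>u\<^sup>2 / 2 - u ^ 3 / 3\<close> and \<open>u\<^sup>2 / 2\<close>.\<close>

lemma integral_square_mono_of_diff_ln:
  fixes X Y :: "real \<Rightarrow> real"
  assumes X: "continuous_on {a..b} X" "\<And>\<theta>. X \<theta> \<ge> 0" and Y: "continuous_on {a..b} Y" "\<And>\<theta>. Y \<theta> \<ge> 0"
    and le: "\<And>s. s > 0 \<Longrightarrow> integral {a..b} (\<lambda>\<theta>. s * X \<theta> - ln (1 + s * X \<theta>)) \<le>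
      integral {a..b} (\<lambda>\<theta>. s * Y \<theta> - ln (1 + s * Y \<theta>))"
  shows "integral {a..b} (\<lambda>\<theta>. (X \<theta>)\<^sup>2) \<le> integral {a..b} (\<lambda>\<theta>. (Y \<theta>)\<^sup>2)"
proof -
  let ?I = "integral {a..b}"
  \<comment> \<open>Dividing the cubic error \<open>s ^ 3 / 3\<close> by
    \<open>s\<^sup>2 / 2\<close> leaves the factor \<open>s * (2 / 3)\<close>, which vanishes as
    \<open>s\<close> tends to 0.\<close>
  have bound: "?I (\<lambda>\<theta>. (X \<theta>)\<^sup>2) \<le> ?I (\<lambda>\<theta>. (Y \<theta>)\<^sup>2) + s * (2 / 3 * ?I (\<lambda>\<theta>. X \<theta> ^ 3))" if s: "s > 0" for s
  proof -
    have nn: "s * X \<theta> \<ge> 0" "s * Y \<theta> \<ge> 0" for \<theta> using s X(2) Y(2) by simp_all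
    have nz: "1 + s * X \<theta> \<noteq> 0" "1 + s * Y \<theta> \<noteq> 0" for \<theta> using nn[of \<theta>] by linarith+
    have "s\<^sup>2 / 2 * ?I (\<lambda>\<theta>. (X \<theta>)\<^sup>2) - s ^ 3 / 3 * ?I (\<lambda>\<theta>. X \<theta> ^ 3) =
        ?I (\<lambda>\<theta>. s\<^sup>2 / 2 * (X \<theta>)\<^sup>2 - s ^ 3 / 3 * X \<theta> ^ 3)"
      by (subst integral_diff)
        (auto intro!: integrable_continuous_interval continuous_intros X(1))
    also have "\<dots> \<le> ?I (\<lambda>\<theta>. s * X \<theta> - ln (1 + s * X \<theta>))"
    proof (rule integral_le)
      show "(\<lambda>\<theta>. s\<^sup>2 / 2 * (X \<theta>)\<^sup>2 - s ^ 3 / 3 * X \<theta> ^ 3) integrable_on {a..b}"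
        "(\<lambda>\<theta>. s * X \<theta> - ln (1 + s * X \<theta>)) integrable_on {a..b}"
        by (intro integrable_continuous_interval continuous_intros X(1) ballI nz)+
      show "s\<^sup>2 / 2 * (X \<theta>)\<^sup>2 - s ^ 3 / 3 * X \<theta> ^ 3 \<le> s * X \<theta> - ln (1 + s * X \<theta>)" for \<theta>
        using ln_one_plus_le_cubic[OF nn(1)[of \<theta>]] by (simp add: power_mult_distrib)
    qed
    also have "\<dots> \<le> ?I (\<lambda>\<theta>. s * Y \<theta> - ln (1 + s * Y \<theta>))" by (rule le[OF s])
    also have "\<dots> \<le> ?I (\<lambda>\<theta>. s\<^sup>2 / 2 * (Y \<theta>)\<^sup>2)"
    proof (rule integral_le)
      show "(\<lambda>\<theta>. s\<^sup>2 / 2 * (Y \<theta>)\<^sup>2) integrable_on {a..b}"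
        "(\<lambda>\<theta>. s * Y \<theta> - ln (1 + s * Y \<theta>)) integrable_on {a..b}"
        by (intro integrable_continuous_interval continuous_intros Y(1) ballI nz)+
      show "s * Y \<theta> - ln (1 + s * Y \<theta>) \<le> s\<^sup>2 / 2 * (Y \<theta>)\<^sup>2" for \<theta>
        using ln_one_plus_ge_quadratic[OF nn(2)[of \<theta>]] by (simp add: power_mult_distrib)
    qed
    also have "\<dots> = s\<^sup>2 / 2 * ?I (\<lambda>\<theta>. (Y \<theta>)\<^sup>2)" by simp
    finally have "s\<^sup>2 / 2 * ?I (\<lambda>\<theta>. (X \<theta>)\<^sup>2) \<le>
        s\<^sup>2 / 2 * (?I (\<lambda>\<theta>. (Y \<theta>)\<^sup>2) + s * (2 / 3 * ?I (\<lambda>\<theta>. X \<theta> ^ 3)))"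
      by (simp add: algebra_simps power2_eq_square power3_eq_cube)
    then show ?thesis using s by simp
  qed
  have "((\<lambda>s. ?I (\<lambda>\<theta>. (Y \<theta>)\<^sup>2) + s * (2 / 3 * ?I (\<lambda>\<theta>. X \<theta> ^ 3))) \<longlongrightarrow>
      ?I (\<lambda>\<theta>. (Y \<theta>)\<^sup>2) + 0 * (2 / 3 * ?I (\<lambda>\<theta>. X \<theta> ^ 3))) (at_right 0)"
    by (intro tendsto_intros)
  then have "?I (\<lambda>\<theta>. (X \<theta>)\<^sup>2) \<le> ?I (\<lambda>\<theta>. (Y \<theta>)\<^sup>2) + 0 * (2 / 3 * ?I (\<lambda>\<theta>. X \<theta> ^ 3))"
  proof (rule tendsto_lowerbound)
    show "\<forall>\<^sub>F s in at_right 0. ?I (\<lambda>\<theta>. (X \<theta>)\<^sup>2) \<le> ?I (\<lambda>\<theta>. (Y \<theta>)\<^sup>2) + s * (2 / 3 * ?I (\<lambda>\<theta>. X \<theta> ^ 3))"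
      by (rule eventually_mono[OF eventually_at_right_less]) (rule bound)
  qed simp
  then show ?thesis by simp
qed

lemma integral_powr_square_fun:
  fixes c :: "'k \<Rightarrow> nat \<Rightarrow> int" and t :: "'k \<Rightarrow> real" and N :: "'k \<Rightarrow> nat"
  assumes A: "finite A"
    and c: "\<And>k j. k \<in> A \<Longrightarrow> j < N k \<Longrightarrow> c k j \<in> {1, -1}"
    and t: "\<And>k. k \<in> A \<Longrightarrow> t k \<ge> 0"
  defines "G \<equiv> square_fun A t N (\<lambda>_ _. 1)" and "F \<equiv> square_fun A t N (\<lambda>k j. of_int (c k j))"
  shows "0 < q \<Longrightarrow> q \<le> 1 \<Longrightarrow> integral {0..2*pi} (\<lambda>\<theta>. G \<theta> powr q) \<le> integral {0..2*pi} (\<lambda>\<theta>. F \<theta> powr q)"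
    and "1 \<le> q \<Longrightarrow> q \<le> 2 \<Longrightarrow> integral {0..2*pi} (\<lambda>\<theta>. F \<theta> powr q) \<le> integral {0..2*pi} (\<lambda>\<theta>. G \<theta> powr q)"
proof -
  let ?I = "integral {0..2*pi}"
  have F: "continuous_on S F" "F \<theta> \<ge> 0" and G: "continuous_on S G" "G \<theta> \<ge> 0" for S \<theta>
    unfolding F_def G_def by (intro continuous_intros square_fun_nonneg t; assumption)+
  \<comment> \<open>The parameter \<open>s\<close> is absorbed into the weights
    \<open>t k\<close>.\<close>
  have ln_le: "?I (\<lambda>\<theta>. ln (1 + s * G \<theta>)) \<le> ?I (\<lambda>\<theta>. ln (1 + s * F \<theta>))" if "s > 0" for s
    using integral_ln_dirichlet_le[of A N c "\<lambda>k. s * t k"] A c t that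
    unfolding square_fun_scale F_def[symmetric] G_def[symmetric] by simp
  have eq: "?I F = ?I G"
  proof -
    have "(real_of_int (c k j))\<^sup>2 = 1\<^sup>2" if "k \<in> A" "j < N k" for k j
      using c[OF that] by (elim insertE) simp_all
    then have "(\<Sum>j<N k. (real_of_int (c k j))\<^sup>2) = (\<Sum>j<N k. 1\<^sup>2)" if "k \<in> A" for k
      using that by (intro sum.cong) auto
    then show ?thesis
      unfolding F_def G_def integral_unique[OF has_integral_square_fun[OF A]] by (intro sum.cong) simp_all
  qed
  \<comment> \<open>The linear terms have equal integrals by \<open>eq\<close>, so the minus sign
    before the logarithm swaps \<open>F\<close> and \<open>G\<close>.\<close>
  have diff_le: "?I (\<lambda>\<theta>. s * F \<theta> - ln (1 + s * F \<theta>)) \<le> ?I (\<lambda>\<theta>. s * G \<theta> - ln (1 + s * G \<theta>))"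
    if s: "s > 0" for s
  proof -
    have "?I (\<lambda>\<theta>. s * Z \<theta> - ln (1 + s * Z \<theta>)) = s * ?I Z - ?I (\<lambda>\<theta>. ln (1 + s * Z \<theta>))"
      if Z: "continuous_on {0..2*pi} Z" "\<And>\<theta>. Z \<theta> \<ge> 0" for Z
    proof -
      have "s * Z \<theta> \<ge> 0" for \<theta> using s Z(2) by simp
      then have nz: "1 + s * Z \<theta> \<noteq> 0" for \<theta> by (metis add_nonneg_eq_0_iff zero_le_one zero_neq_one)
      show ?thesis
        by (subst integral_diff) (auto intro!: integrable_continuous_interval continuous_intros Z(1) nz)
    qed
    then show ?thesis using ln_le[OF s] F G eq by simp
  qed
  have powr_1: "(\<lambda>\<theta>. F \<theta> powr 1) = F" "(\<lambda>\<theta>. G \<theta> powr 1) = G" using F(2) G(2) by auto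
  show "?I (\<lambda>\<theta>. G \<theta> powr q) \<le> ?I (\<lambda>\<theta>. F \<theta> powr q)" if q: "0 < q" "q \<le> 1"
  proof (cases "q = 1")
    case True
    then show ?thesis using eq powr_1 by simp
  next
    case False
    with q have q: "0 < q" "q < 1" by auto
    show ?thesis
      by (rule integral_powr_mono_of_kernel[where \<phi> = "\<lambda>u. ln (1 + u)"])
        (use q mellin_const_ln[OF q] F G ln_le in \<open>auto intro!: continuous_intros\<close>)
  qed
  show "?I (\<lambda>\<theta>. F \<theta> powr q) \<le> ?I (\<lambda>\<theta>. G \<theta> powr q)" if q: "1 \<le> q" "q \<le> 2"
  proof -
    consider "q = 1" | "q = 2" | "1 < q" "q < 2" using q by linarith
    then show ?thesis
    proof cases
      case 1
      then show ?thesis using eq powr_1 by simp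
    next
      case 2
      then show ?thesis
        using integral_square_mono_of_diff_ln[OF F(1) F(2) G(1) G(2) diff_le] F(2) G(2)
        by (simp add: powr_numeral)
    next
      case 3
      show ?thesis
        by (rule integral_powr_mono_of_kernel[where \<phi> = "\<lambda>u. u - ln (1 + u)"])
          (use 3 mellin_const_diff_ln[OF 3] F G diff_le in \<open>auto intro!: continuous_intros ln_add_one_self_le_self\<close>)
    qed
  qed
qed

section \<open>Passage to the norms of Littlewood polynomials\<close>

text \<open>For continuous \<open>h\<close> and \<open>p > 0\<close> the integrand is continuous
  even at zeros of \<open>h\<close>, so the Lebesgue integral in \<open>circle_norm\<close> is the
  gauge integral and its default value does not occur.\<close>

lemma circle_norm_sqrt:
  assumes h: "continuous_on {0..2*pi} h" "\<And>\<theta>. h \<theta> \<ge> 0" and "p > 0"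
  shows "circle_norm p (\<lambda>\<theta>. sqrt (h \<theta>)) = (integral {0..2*pi} (\<lambda>\<theta>. h \<theta> powr (p / 2)) / (2 * pi)) powr (1 / p)"
proof -
  have "norm (sqrt (h \<theta>)) powr p = h \<theta> powr (p / 2)" for \<theta>
    using h(2)[of \<theta>] by (simp add: powr_half_sqrt[symmetric] powr_powr)
  moreover have "continuous_on {0..2*pi} (\<lambda>\<theta>. h \<theta> powr (p / 2))"
    by (intro continuous_on_powr' continuous_on_const h(1)) (use h(2) \<open>p > 0\<close> in auto)
  then have "set_integrable lborel {0..2*pi} (\<lambda>\<theta>. h \<theta> powr (p / 2))"
    by (rule borel_integrable_atLeastAtMost')
  ultimately show ?thesis
    unfolding circle_norm_def by (simp add: set_borel_integral_eq_integral(2))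
qed

text \<open>The parity argument needs integer minors, hence integer instead of complex
  coefficients.\<close>

lemma littlewood_polys_int_coeffs:
  assumes "f \<in> littlewood_polys n"
  obtains c :: "nat \<Rightarrow> int" where "\<And>j. j < n \<Longrightarrow> c j \<in> {1, -1}"
    and "\<And>z. poly f z = (\<Sum>j<n. of_real (of_int (c j)) * z ^ j)"
proof -
  obtain d where d: "\<And>j. j < n \<Longrightarrow> d j \<in> {1, -1}" and f: "f = (\<Sum>j<n. Polynomial.monom (d j) j)"
    using assms unfolding littlewood_polys_def by blast
  show ?thesis
  proof (rule that[of "\<lambda>j. if d j = 1 then 1 else -1"])
    fix z
    have "of_real (of_int (if d j = 1 then 1 else -1)) = d j" if "j < n" for j
      using d[OF that] by auto
    then show "poly f z = (\<Sum>j<n. of_real (of_int (if d j = 1 then 1 else -1)) * z ^ j)"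
      unfolding f by (simp add: poly_sum poly_monom)
  qed auto
qed

theorem mainTheorem2:
  fixes K :: nat and N :: "nat \<Rightarrow> nat"
    and f :: "nat \<Rightarrow> complex poly" and t :: "nat \<Rightarrow> real"
  assumes "K \<ge> 1"
    and "\<And>k. k \<in> {1..K} \<Longrightarrow> N k \<ge> 1"
    and "\<And>k. k \<in> {1..K} \<Longrightarrow> f k \<in> littlewood_polys (N k)"
    and "\<And>k. k \<in> {1..K} \<Longrightarrow> t k > 0"
  shows "(\<forall>p::real. 0 < p \<and> p \<le> 2 \<longrightarrow>
            circle_norm p (\<lambda>\<theta>. sqrt (\<Sum>k=1..K. t k * (cmod (poly (dirichlet_poly (N k)) (cis \<theta>)))\<^sup>2))
            \<le> circle_norm p (\<lambda>\<theta>. sqrt (\<Sum>k=1..K. t k * (cmod (poly (f k) (cis \<theta>)))\<^sup>2))) \<and>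
         (\<forall>p::real. 2 \<le> p \<and> p \<le> 4 \<longrightarrow>
            circle_norm p (\<lambda>\<theta>. sqrt (\<Sum>k=1..K. t k * (cmod (poly (dirichlet_poly (N k)) (cis \<theta>)))\<^sup>2))
            \<ge> circle_norm p (\<lambda>\<theta>. sqrt (\<Sum>k=1..K. t k * (cmod (poly (f k) (cis \<theta>)))\<^sup>2)))"
proof -
  let ?A = "{1..K}"
  have "\<exists>c :: nat \<Rightarrow> int. \<forall>z. (\<forall>j<N k. c j \<in> {1, -1}) \<and> poly (f k) z = (\<Sum>j<N k. of_real (of_int (c j)) * z ^ j)"
    if "k \<in> ?A" for k
    using littlewood_polys_int_coeffs[OF assms(3)[OF that]] by metis
  then obtain c :: "nat \<Rightarrow> nat \<Rightarrow> int" where c: "\<And>k j. k \<in> ?A \<Longrightarrow> j < N k \<Longrightarrow> c k j \<in> {1, -1}"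
    and f: "\<And>k z. k \<in> ?A \<Longrightarrow> poly (f k) z = (\<Sum>j<N k. of_real (of_int (c k j)) * z ^ j)"
    by metis
  have t: "t k \<ge> 0" if "k \<in> ?A" for k using assms(4)[OF that] by simp
  define G where "G = square_fun ?A t N (\<lambda>_ _. 1)"
  define F where "F = square_fun ?A t N (\<lambda>k j. of_int (c k j))"
  have G_eq: "(\<Sum>k=1..K. t k * (cmod (poly (dirichlet_poly (N k)) (cis \<theta>)))\<^sup>2) = G \<theta>" for \<theta>
    unfolding G_def square_fun_def dirichlet_poly_def by (simp add: poly_sum poly_monom)
  have F_eq: "(\<Sum>k=1..K. t k * (cmod (poly (f k) (cis \<theta>)))\<^sup>2) = F \<theta>" for \<theta>
    unfolding F_def square_fun_def by (intro sum.cong refl) (simp only: f)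
  have F: "continuous_on S F" "F \<theta> \<ge> 0" and G: "continuous_on S G" "G \<theta> \<ge> 0" for S \<theta>
    unfolding F_def G_def by (intro continuous_intros square_fun_nonneg t; assumption)+
  have mono: "circle_norm p (\<lambda>\<theta>. sqrt (X \<theta>)) \<le> circle_norm p (\<lambda>\<theta>. sqrt (Y \<theta>))"
    if "integral {0..2*pi} (\<lambda>\<theta>. X \<theta> powr (p / 2)) \<le> integral {0..2*pi} (\<lambda>\<theta>. Y \<theta> powr (p / 2))" "p > 0"
      and X: "continuous_on {0..2*pi} X" "\<And>\<theta>. X \<theta> \<ge> 0" and Y: "continuous_on {0..2*pi} Y" "\<And>\<theta>. Y \<theta> \<ge> 0"
    for p X Y
  proof -
    \<comment> \<open>Monotonicity of \<open>powr\<close> in its base requires the smaller base to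
      be nonnegative.\<close>
    have "(\<lambda>\<theta>. X \<theta> powr (p / 2)) integrable_on {0..2*pi}"
      by (intro integrable_continuous_interval continuous_on_powr' continuous_on_const X(1))
        (use X(2) \<open>p > 0\<close> in auto)
    then have "0 \<le> integral {0..2*pi} (\<lambda>\<theta>. X \<theta> powr (p / 2))"
      by (rule integral_nonneg) simp
    then show ?thesis
      unfolding circle_norm_sqrt[OF X \<open>p > 0\<close>] circle_norm_sqrt[OF Y \<open>p > 0\<close>]
      using that(1,2) by (intro powr_mono2 divide_right_mono) auto
  qed
  \<comment> \<open>The square root halves the exponent: with \<open>q = p / 2\<close>, the range
    \<open>0 < p \<le> 2\<close> becomes \<open>0 < q \<le> 1\<close>, and
    \<open>2 \<le> p \<le> 4\<close> becomes \<open>1 \<le> q \<le> 2\<close>.\<close>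
  have powr_le: "integral {0..2*pi} (\<lambda>\<theta>. G \<theta> powr q) \<le> integral {0..2*pi} (\<lambda>\<theta>. F \<theta> powr q)"
    if "0 < q" "q \<le> 1" for q
    unfolding F_def G_def by (rule integral_powr_square_fun(1)) (use c t that in blast)+
  have powr_ge: "integral {0..2*pi} (\<lambda>\<theta>. F \<theta> powr q) \<le> integral {0..2*pi} (\<lambda>\<theta>. G \<theta> powr q)"
    if "1 \<le> q" "q \<le> 2" for q
    unfolding F_def G_def by (rule integral_powr_square_fun(2)) (use c t that in blast)+
  show ?thesis
    unfolding G_eq F_eq
  proof (intro conjI allI impI)
    fix p :: real assume "0 < p \<and> p \<le> 2"
    then show "circle_norm p (\<lambda>\<theta>. sqrt (G \<theta>)) \<le> circle_norm p (\<lambda>\<theta>. sqrt (F \<theta>))"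
      by (intro mono powr_le F G) auto
  next
    fix p :: real assume "2 \<le> p \<and> p \<le> 4"
    then show "circle_norm p (\<lambda>\<theta>. sqrt (F \<theta>)) \<le> circle_norm p (\<lambda>\<theta>. sqrt (G \<theta>))"
      by (intro mono powr_ge F G) auto
  qed
qed

end
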